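(* Let $\Gamma$ be a complex hyperbolic triangle group of type $[m_1,m_2,m_3;n_1,n_2,n_3]$ with $m_3=0$ and $n_3=2$, where $(n_1,n_2)$ is one of the pairs in the table below, and let $\alpha$ be its angular invariant. Set \[D=4\cosh\left(\frac{m_1}{2}\right)\cosh\left(\frac{m_2}{2}\right)\sin^2\left(\frac{\alpha}{2}\right)+\left(\cosh\left(\frac{m_1}{2}\right)-\cosh\left(\frac{m_2}{2}\right)\right)^2 .\] Then $\Gamma$ is non-discrete in $\mathrm{PU}(2,1)$ if \[D<\frac{2}{\nu_1}\qquad\text{and}\qquad D\ne\frac{2\cos(\pi/q)}{\nu_1}\ \text{ for every integer } q\ge q_0,\] where $\nu_1$ and $q_0$ are given by \[\begin{array}{c|cccccc} (n_1,n_2) & (3,3) & (2,3) & (2,6) & (3,6) & (2,4) & (4,4)\\ \hline \nu_1 & 6\sqrt3 & 24\sqrt3 & 4\sqrt3 & 2\sqrt3 & 16 & 4\\ q_0 & 6 & 6 & 4 & 3 & 3 & 4 \end{array}\]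
   Context: Let $\mathbb C^{2,1}$ be $\mathbb C^3$ with the Hermitian form $\langle z,w\rangle=z_1\bar w_1+z_2\bar w_2-z_3\bar w_3$. The complex hyperbolic plane $H^2_{\mathbb C}$ is the set of lines spanned by vectors $z$ with $\langle z,z\rangle<0$, and its boundary $\partial H^2_{\mathbb C}$ is the set of lines spanned by $z\ne0$ with $\langle z,z\rangle=0$. The distance $\rho$ (Bergman metric) is given by $\cosh^2(\rho([z],[w])/2)=\frac{\langle z,w\rangle\langle w,z\rangle}{\langle z,z\rangle\langle w,w\rangle}$. The group of holomorphic isometries is $\mathrm{PU}(2,1)$. A complex geodesic $C$ is the projectivisation of $\{z:\langle c,z\rangle=0\}$ for a vector $c$ with $\langle c,c\rangle>0$, called a polar vector of $C$ (unique up to scaling); $c$ is normalised if $\langle c,c\rangle=1$. Two complex geodesics $C,C'$ with normalised polar vectors $c,c'$ are ultra-parallel if they have no common point in $H^2_{\mathbb C}\cup\partial H^2_{\mathbb C}$, in which case $|\langle c,c'\rangle|=\cosh(\mathrm{dist}(C,C')/2)>1$; they are ideal if they have a common point in $\partial H^2_{\mathbb C}$ (and are disjoint in $H^2_{\mathbb C}$), in which case $|\langle c,c'\rangle|=1$ and $\mathrm{dist}(C,C')=0$. The minimal complex reflection of order $n$ in $C$ is the element of $\mathrm{PU}(2,1)$ of order $n$ with fixed point set $C$ induced by $z\mapsto -z+(1-\mu)\frac{\langle z,c\rangle}{\langle c,c\rangle}c$, where $\mu=\exp(2\pi i/n)$. An ultra-parallel $[m_1,m_2,m_3]$-triangle is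 a triple $(C_1,C_2,C_3)$ of complex geodesics, pairwise disjoint in $H^2_{\mathbb C}$, with $\mathrm{dist}(C_{k-1},C_{k+1})=m_k$ for $k=1,2,3$ (indices mod 3); $m_k=0$ is allowed and means that $C_{k-1},C_{k+1}$ are ideal. A complex hyperbolic (ultra-parallel) triangle group of type $[m_1,m_2,m_3;n_1,n_2,n_3]$ is the subgroup $\langle\iota_1,\iota_2,\iota_3\rangle$ of $\mathrm{PU}(2,1)$, where $\iota_k$ is the minimal complex reflection of order $n_k$ in $C_k$ and $(C_1,C_2,C_3)$ is an ultra-parallel $[m_1,m_2,m_3]$-triangle. Its angular invariant is $\alpha=\arg\left(\prod_{k=1}^3\langle c_{k-1},c_{k+1}\rangle\right)\in[0,2\pi]$, where $c_k$ is a normalised polar vector of $C_k$.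
   Formalization: The three complex geodesics are additionally assumed to have no common boundary point, which is equivalent to D > 0; for D = 0 the claim fails, e.g. three ideal geodesics through one boundary point can generate a discrete group with Gaussian integer entries. *)

theory Defs
  imports "HOL-Analysis.Analysis" "HOL-Algebra.Generated_Groups"
begin

type_synonym cpoint = "(complex ^ 3) set"  \<comment> \<open>a complex line through the origin of C^3\<close>

definition herm :: "complex ^ 3 \<Rightarrow> complex ^ 3 \<Rightarrow> complex" where
  "herm z w = z $ 1 * cnj (w $ 1) + z $ 2 * cnj (w $ 2) - z $ 3 * cnj (w $ 3)"

text \<open>Since \<open>herm z z\<close> is always real, its sign is expressed through its real part.\<close>

definition H2C :: "cpoint set" where
  "H2C = {vec.span {z} | z. Re (herm z z) < 0}"

definition bdry_H2C :: "cpoint set" where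
  "bdry_H2C = {vec.span {z} | z. z \<noteq> 0 \<and> herm z z = 0}"

definition bergman_dist :: "cpoint \<Rightarrow> cpoint \<Rightarrow> real" where
  "bergman_dist p q = (THE r. 0 \<le> r \<and> (\<forall>z \<in> p - {0}. \<forall>w \<in> q - {0}.
     complex_of_real ((cosh (r / 2))\<^sup>2) = (herm z w * herm w z) / (herm z z * herm w w)))"


text \<open>
  The whole projective line is kept, so that a complex geodesic also contains its points on the
  boundary; it is intersected with \<open>H2C\<close> or \<open>bdry_H2C\<close> where needed.
\<close>

definition polar_vector :: "complex ^ 3 \<Rightarrow> cpoint set \<Rightarrow> bool" where
  "polar_vector c C \<longleftrightarrow> 0 < Re (herm c c) \<and> C = {vec.span {z} | z. z \<noteq> 0 \<and> herm c z = 0}"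

definition normalised_polar_vector :: "complex ^ 3 \<Rightarrow> cpoint set \<Rightarrow> bool" where
  "normalised_polar_vector c C \<longleftrightarrow> polar_vector c C \<and> herm c c = 1"

definition complex_geodesic :: "cpoint set \<Rightarrow> bool" where
  "complex_geodesic C \<longleftrightarrow> (\<exists>c. polar_vector c C)"

definition geodesic_dist :: "cpoint set \<Rightarrow> cpoint set \<Rightarrow> real" where
  "geodesic_dist C C' = (INF (p, q) \<in> (C \<inter> H2C) \<times> (C' \<inter> H2C). bergman_dist p q)"


definition U21 :: "(complex ^ 3 ^ 3) monoid" where
  "U21 = \<lparr>carrier = {A. \<forall>z w. herm (A *v z) (A *v w) = herm z w}, mult = (**), one = mat 1\<rparr>"

definition unit_scalars :: "(complex ^ 3 ^ 3) set" where
  "unit_scalars = {mat u | u. cmod u = 1}"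

definition PU21 :: "(complex ^ 3 ^ 3) set monoid" where
  "PU21 = U21 Mod unit_scalars"

definition proj_class :: "complex ^ 3 ^ 3 \<Rightarrow> (complex ^ 3 ^ 3) set" where
  "proj_class A = unit_scalars #>\<^bsub>U21\<^esub> A"

definition PU21_open :: "(complex ^ 3 ^ 3) set set \<Rightarrow> bool" where
  "PU21_open V \<longleftrightarrow> V \<subseteq> carrier PU21 \<and>
     openin (top_of_set (carrier U21)) {A \<in> carrier U21. proj_class A \<in> V}"

text \<open>The quotient topology of the Lie group topology on U(2,1).\<close>

definition PU21_topology :: "(complex ^ 3 ^ 3) set topology" where
  "PU21_topology = topology PU21_open"

lemma openin_PU21_topology: "openin PU21_topology = PU21_open"
proof -
  have inter: "PU21_open (S \<inter> T)" if "PU21_open S" "PU21_open T" for S T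
  proof -
    have "{A \<in> carrier U21. proj_class A \<in> S \<inter> T} =
        {A \<in> carrier U21. proj_class A \<in> S} \<inter> {A \<in> carrier U21. proj_class A \<in> T}" by blast
    with that show ?thesis unfolding PU21_open_def by (auto intro: openin_Int)
  qed
  have union: "PU21_open (\<Union>K)" if "\<forall>S\<in>K. PU21_open S" for K
  proof -
    have "{A \<in> carrier U21. proj_class A \<in> \<Union>K} =
        \<Union>((\<lambda>S. {A \<in> carrier U21. proj_class A \<in> S}) ` K)" by blast
    with that show ?thesis unfolding PU21_open_def by (auto intro!: openin_Union)
  qed
  have "istopology PU21_open"
    unfolding istopology_def using inter union by blast
  then show ?thesis
    by (simp add: PU21_topology_def topology_inverse')
qed

definition discrete_in_PU21 :: "(complex ^ 3 ^ 3) set set \<Rightarrow> bool" where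
  "discrete_in_PU21 \<Gamma> \<longleftrightarrow> subtopology PU21_topology \<Gamma> = discrete_topology \<Gamma>"


definition reflection_map :: "nat \<Rightarrow> complex ^ 3 \<Rightarrow> complex ^ 3 \<Rightarrow> complex ^ 3" where
  "reflection_map n c z = - z + ((1 - exp (2 * of_real pi * \<i> / of_nat n)) * (herm z c / herm c c)) *s c"

definition minimal_reflection :: "nat \<Rightarrow> cpoint set \<Rightarrow> (complex ^ 3 ^ 3) set \<Rightarrow> bool" where
  "minimal_reflection n C g \<longleftrightarrow>
     (\<exists>c. polar_vector c C \<and> g = proj_class (matrix (reflection_map n c)))"

text \<open>
  Triples are indexed by the numeral type \<open>3\<close>, whose arithmetic is modulo 3; thus the index
  \<open>3\<close> is also \<open>0\<close>, and \<open>k - 1\<close>, \<open>k + 1\<close> are the cyclic neighbours of \<open>k\<close>.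
\<close>

definition ultraparallel_triangle :: "(3 \<Rightarrow> real) \<Rightarrow> (3 \<Rightarrow> cpoint set) \<Rightarrow> bool" where
  "ultraparallel_triangle m C \<longleftrightarrow>
     (\<forall>k. complex_geodesic (C k)) \<and>
     (\<forall>j k. j \<noteq> k \<longrightarrow> C j \<inter> C k \<inter> H2C = {}) \<and>
     (\<forall>k. geodesic_dist (C (k - 1)) (C (k + 1)) = m k)"

text \<open>\<open>\<Gamma>\<close> is the group of type \<open>[m 1, m 2, m 3; n 1, n 2, n 3]\<close> given by the triangle \<open>C\<close>.\<close>

definition triangle_group ::
  "(3 \<Rightarrow> real) \<Rightarrow> (3 \<Rightarrow> nat) \<Rightarrow> (3 \<Rightarrow> cpoint set) \<Rightarrow> (complex ^ 3 ^ 3) set set \<Rightarrow> bool" where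
  "triangle_group m n C \<Gamma> \<longleftrightarrow> ultraparallel_triangle m C \<and>
     (\<exists>\<iota>. (\<forall>k. minimal_reflection (n k) (C k) (\<iota> k)) \<and> \<Gamma> = generate PU21 (range \<iota>))"

text \<open>
  A relation rather than a function, because on the closed interval from 0 to \<open>2 * pi\<close> both
  endpoints are arguments of a positive real number.
\<close>

definition angular_invariant :: "(3 \<Rightarrow> cpoint set) \<Rightarrow> real \<Rightarrow> bool" where
  "angular_invariant C \<alpha> \<longleftrightarrow> 0 \<le> \<alpha> \<and> \<alpha> \<le> 2 * pi \<and>
     (\<exists>c. (\<forall>k. normalised_polar_vector (c k) (C k)) \<and>
          is_Arg (\<Prod>k\<in>UNIV. herm (c (k - 1)) (c (k + 1))) \<alpha>)"

end

theory Submission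
  imports Defs
begin

text \<open>
  Scale normalised polar vectors of \<open>C 1\<close>, \<open>C 2\<close> so that \<open>\<langle>c\<^sub>1,c\<^sub>2\<rangle> = 1\<close>. Then \<open>p = c\<^sub>1 - c\<^sub>2\<close> is null
  and spans the common boundary point of the two geodesics, and \<open>D = |\<langle>p,c\<^sub>3\<rangle>|\<^sup>2\<close>. A power of
  \<open>\<iota>\<^sub>1\<iota>\<^sub>2\<close> is the vertical Heisenberg translation \<open>T z = z + i(\<nu>\<^sub>1/2)\<langle>z,p\<rangle>p\<close>. Shimizu's lemma
  says that in a discrete group \<open>(\<nu>\<^sub>1/2)|\<langle>h p,p\<rangle>|\<close> is either 0 or at least 1. Applied to powers
  \<open>h = (T \<iota>\<^sub>3)\<^sup>k\<close>, which act on the complex geodesic through \<open>p\<close> and \<open>\<iota>\<^sub>3 p\<close> like a Hecke group, it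
  forces \<open>\<nu>\<^sub>1 D = 2 cos(\<pi>/q)\<close> with \<open>q \<ge> 3\<close>. Applied to \<open>h = \<iota>\<^sub>3 g \<iota>\<^sub>3\<close>, where \<open>g\<close> is a conjugate of \<open>\<iota>\<^sub>1\<close>
  or \<open>\<iota>\<^sub>2\<close> in \<open>\<langle>\<iota>\<^sub>1,\<iota>\<^sub>2\<rangle>\<close>, it bounds from below the distance from the vertical chain of that geodesic
  to the rotation centres of the Euclidean group induced by \<open>\<langle>\<iota>\<^sub>1,\<iota>\<^sub>2\<rangle>\<close>; since some centre is always
  near, \<open>q < q\<^sub>0\<close> is impossible.
\<close>

section \<open>The form and the group PU(2,1)\<close>

lemma vec3_eq_iff: "z = w \<longleftrightarrow> z $ 1 = w $ 1 \<and> z $ 2 = w $ 2 \<and> z $ 3 = w $ 3"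
  for z w :: "'a ^ 3"
  by (auto simp: vec_eq_iff forall_3)

lemma herm_add_left: "herm (x + y) w = herm x w + herm y w"
  and herm_add_right: "herm w (x + y) = herm w x + herm w y"
  and herm_diff_left: "herm (x - y) w = herm x w - herm y w"
  and herm_diff_right: "herm w (x - y) = herm w x - herm w y"
  and herm_minus_left: "herm (- x) w = - herm x w"
  and herm_minus_right: "herm w (- x) = - herm w x"
  and herm_scale_left: "herm (k *s x) w = k * herm x w"
  and herm_scale_right: "herm w (k *s x) = cnj k * herm w x"
  by (simp_all add: herm_def algebra_simps)

lemmas herm_simps = herm_add_left herm_add_right herm_diff_left herm_diff_right
  herm_minus_left herm_minus_right herm_scale_left herm_scale_right

lemma herm_zero_left [simp]: "herm 0 w = 0"
  and herm_zero_right [simp]: "herm w 0 = 0"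
  by (simp_all add: herm_def)

lemma cnj_herm: "cnj (herm z w) = herm w z"
  by (simp add: herm_def mult.commute)

lemma cmod_herm_commute: "cmod (herm z w) = cmod (herm w z)"
  by (metis cnj_herm complex_mod_cnj)

lemma herm_mult_swap: "herm z w * herm w z = (cmod (herm z w))\<^sup>2"
  by (metis cnj_herm complex_norm_square)

lemma herm_self_real: "herm z z = of_real (Re (herm z z))"
  by (simp add: complex_eq_iff herm_def)

lemma herm_nondegenerate:
  assumes "\<And>w. herm z w = 0"
  shows "z = 0"
  using assms[of "axis 1 1"] assms[of "axis 2 1"] assms[of "axis 3 1"]
  by (simp add: herm_def axis_def vec3_eq_iff)

section \<open>Isometries of the form and their quotient by unit scalars\<close>

lemma U21_carrier_iff: "A \<in> carrier U21 \<longleftrightarrow> (\<forall>z w. herm (A *v z) (A *v w) = herm z w)"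
  by (simp add: U21_def)

lemma U21_mult [simp]: "A \<otimes>\<^bsub>U21\<^esub> B = A ** B"
  and U21_one [simp]: "\<one>\<^bsub>U21\<^esub> = mat 1"
  by (simp_all add: U21_def)

lemma U21_herm: "A \<in> carrier U21 \<Longrightarrow> herm (A *v z) (A *v w) = herm z w"
  by (simp add: U21_carrier_iff)

text \<open>Nondegeneracy makes the kernel of an isometry trivial. In finite dimension the resulting
  left inverse is two-sided, which is why it preserves the form as well.\<close>

lemma U21_left_inverse:
  assumes "A \<in> carrier U21"
  shows "\<exists>B\<in>carrier U21. B ** A = mat 1"
proof -
  have "x = 0" if "A *v x = 0" for x
    using herm_nondegenerate[of x] U21_herm[OF assms, of x] that by simp
  then obtain B where B: "B ** A = mat 1"
    using matrix_left_invertible_ker[of A] by blast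
  then have AB: "A ** B = mat 1"
    by (rule matrix_left_right_inverse1)
  have "herm (B *v z) (B *v w) = herm z w" for z w
    using U21_herm[OF assms, of "B *v z" "B *v w"] AB by (simp add: matrix_vector_mul_assoc)
  then show ?thesis
    using B by (auto simp: U21_carrier_iff)
qed

lemma group_U21: "group U21"
proof (rule groupI)
  show "\<exists>y\<in>carrier U21. y \<otimes>\<^bsub>U21\<^esub> x = \<one>\<^bsub>U21\<^esub>" if "x \<in> carrier U21" for x
    using U21_left_inverse[OF that] by simp
qed (auto simp: U21_carrier_iff matrix_mul_assoc simp flip: matrix_vector_mul_assoc)

interpretation U21: group U21
  by (rule group_U21)

lemma mat_mult_vector: "mat u *v z = u *s z" for z :: "complex ^ 'n"
  by (simp add: vec_eq_iff matrix_vector_mult_def mat_def if_distrib[of "\<lambda>a. a * _"] cong: if_cong)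

lemma mat_mult_mat: "mat u ** mat v = (mat (u * v) :: complex ^ 'n ^ 'n)"
  by (simp add: matrix_eq mat_mult_vector flip: matrix_vector_mul_assoc)

lemma mat_mult_commute: "mat u ** A = A ** mat u" for A :: "complex ^ 'n ^ 'n"
  by (simp add: matrix_eq mat_mult_vector vector_scalar_commute flip: matrix_vector_mul_assoc)

lemma cnj_mult_unit: "cmod u = 1 \<Longrightarrow> cnj u * u = 1"
  using complex_norm_square[of u] by (simp add: mult.commute)

lemma unit_scalar_in_U21: "cmod u = 1 \<Longrightarrow> mat u \<in> carrier U21"
  by (simp add: U21_carrier_iff mat_mult_vector herm_simps cnj_mult_unit flip: mult.assoc)

lemma subgroup_unit_scalars: "subgroup unit_scalars U21"
proof (rule U21.subgroupI)
  show "unit_scalars \<subseteq> carrier U21" "unit_scalars \<noteq> {}"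
    using unit_scalar_in_U21 by (auto simp: unit_scalars_def intro: exI[of _ 1])
next
  fix A assume "A \<in> unit_scalars"
  then obtain u where u: "A = mat u" "cmod u = 1"
    by (auto simp: unit_scalars_def)
  have "mat (cnj u) ** mat u = (mat 1 :: complex ^ 3 ^ 3)"
    using u by (simp add: mat_mult_mat cnj_mult_unit)
  then have "inv\<^bsub>U21\<^esub> A = mat (cnj u)"
    using u by (intro U21.inv_equality) (auto intro: unit_scalar_in_U21)
  then show "inv\<^bsub>U21\<^esub> A \<in> unit_scalars"
    using u by (auto simp: unit_scalars_def)
next
  fix A B assume "A \<in> unit_scalars" "B \<in> unit_scalars"
  then show "A \<otimes>\<^bsub>U21\<^esub> B \<in> unit_scalars"
    by (auto simp: unit_scalars_def mat_mult_mat norm_mult)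
qed

interpretation unit_scalars: normal unit_scalars U21
proof (rule U21.normalI[OF subgroup_unit_scalars])
  show "\<forall>A\<in>carrier U21. unit_scalars #>\<^bsub>U21\<^esub> A = A <#\<^bsub>U21\<^esub> unit_scalars"
    by (auto simp: r_coset_def l_coset_def unit_scalars_def mat_mult_commute)
qed

interpretation PU21: group PU21
  unfolding PU21_def by (rule unit_scalars.factorgroup_is_group)

lemma proj_class_hom: "proj_class \<in> hom U21 PU21"
  unfolding proj_class_def PU21_def by (rule unit_scalars.r_coset_hom_Mod)

interpretation proj_class: group_hom U21 PU21 proj_class
  by unfold_locales (rule proj_class_hom)

lemma proj_class_mat_mult:
  assumes "cmod u = 1" "A \<in> carrier U21"
  shows "proj_class (mat u ** A) = proj_class A"
proof -
  have m: "mat u \<in> unit_scalars" "mat u \<in> carrier U21"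
    using assms unit_scalar_in_U21 by (auto simp: unit_scalars_def)
  have "unit_scalars #>\<^bsub>U21\<^esub> (mat u \<otimes>\<^bsub>U21\<^esub> A) = (unit_scalars #>\<^bsub>U21\<^esub> mat u) #>\<^bsub>U21\<^esub> A"
    using assms m unit_scalars.subset by (simp only: U21.coset_mult_assoc)
  also have "unit_scalars #>\<^bsub>U21\<^esub> mat u = unit_scalars"
    using m by (simp add: U21.coset_join2 subgroup_unit_scalars)
  finally show ?thesis
    by (simp add: proj_class_def)
qed

lemma proj_class_eq_imp:
  assumes "A \<in> carrier U21" "proj_class A = proj_class B"
  shows "\<exists>u. cmod u = 1 \<and> A = mat u ** B"
proof -
  have "A \<in> unit_scalars #>\<^bsub>U21\<^esub> B"
    using U21.rcos_self[OF assms(1) subgroup_unit_scalars] assms(2) by (simp add: proj_class_def)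
  then show ?thesis
    by (auto simp: r_coset_def unit_scalars_def)
qed

text \<open>The preimage in U(2,1), where products and limits can be computed with matrices instead
  of cosets.\<close>

definition lift :: "(complex ^ 3 ^ 3) set set \<Rightarrow> (complex ^ 3 ^ 3) set" where
  "lift \<Gamma> = {A \<in> carrier U21. proj_class A \<in> \<Gamma>}"

lemma subgroup_lift:
  assumes "subgroup \<Gamma> PU21"
  shows "subgroup (lift \<Gamma>) U21"
proof (rule U21.subgroupI)
  show "lift \<Gamma> \<subseteq> carrier U21"
    by (auto simp: lift_def)
  show "lift \<Gamma> \<noteq> {}"
    using subgroup.one_closed[OF assms] proj_class.hom_one U21.one_closed by (auto simp: lift_def)
next
  fix A assume "A \<in> lift \<Gamma>"
  then show "inv\<^bsub>U21\<^esub> A \<in> lift \<Gamma>"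
    using subgroup.m_inv_closed[OF assms] by (auto simp: lift_def)
next
  fix A B assume "A \<in> lift \<Gamma>" "B \<in> lift \<Gamma>"
  then show "A \<otimes>\<^bsub>U21\<^esub> B \<in> lift \<Gamma>"
    using subgroup.m_closed[OF assms] proj_class.hom_mult[of A B] U21.m_closed[of A B] by (auto simp: lift_def)
qed

text \<open>A neighbourhood isolating the class of \<open>B\<close> pulls back to a relatively open
  subset of U(2,1), which some \<open>A k\<close> must enter although its class is a different
  one.\<close>

lemma not_discrete_if_accumulation:
  assumes A: "\<And>k::nat. A k \<in> lift \<Gamma>" and B: "B \<in> lift \<Gamma>"
    and lim: "A \<longlonglongrightarrow> B" and ne: "\<And>k. proj_class (A k) \<noteq> proj_class B"
  shows "\<not> discrete_in_PU21 \<Gamma>"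
proof
  assume "discrete_in_PU21 \<Gamma>"
  then have "openin (subtopology PU21_topology \<Gamma>) {proj_class B}"
    using B by (simp add: discrete_in_PU21_def lift_def)
  then obtain V where V: "PU21_open V" "{proj_class B} = V \<inter> \<Gamma>"
    by (auto simp: openin_subtopology openin_PU21_topology)
  then have "openin (top_of_set (carrier U21)) {A \<in> carrier U21. proj_class A \<in> V}"
    by (simp add: PU21_open_def)
  then obtain W where W: "open W" "{A \<in> carrier U21. proj_class A \<in> V} = carrier U21 \<inter> W"
    by (auto simp: openin_open)
  have "B \<in> W"
    using B V(2) W(2) by (auto simp: lift_def)
  with lim W(1) have "\<forall>\<^sub>F k in sequentially. A k \<in> W"
    by (rule topological_tendstoD)
  then obtain k where "A k \<in> W"
    by (auto simp: eventually_sequentially)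
  with A[of k] W(2) have "proj_class (A k) \<in> V \<inter> \<Gamma>"
    by (auto simp: lift_def)
  with V(2) ne[of k] show False
    by auto
qed

section \<open>Distance of complex geodesics\<close>

lemma herm_self_eq: "herm z z = of_real ((cmod (z $ 1))\<^sup>2 + (cmod (z $ 2))\<^sup>2 - (cmod (z $ 3))\<^sup>2)"
  by (simp add: herm_def complex_norm_square del: of_real_power)

lemma Re_herm_self: "Re (herm z z) = (cmod (z $ 1))\<^sup>2 + (cmod (z $ 2))\<^sup>2 - (cmod (z $ 3))\<^sup>2"
  by (simp only: herm_self_eq Re_complex_of_real)

text \<open>Only two negative vectors need work. With \<open>g\<close>, \<open>d\<close> the norms
  of the first two coordinates, the modulus of \<open>herm z w\<close> is at least
  \<open>a * b - g * d\<close>, whose square exceeds the left-hand side by the square of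
  \<open>a * d - b * g\<close>.\<close>

lemma reverse_Cauchy_Schwarz:
  assumes "Re (herm z z) < 0"
  shows "Re (herm z z) * Re (herm w w) \<le> (cmod (herm z w))\<^sup>2"
proof (cases "Re (herm w w) < 0")
  case False
  then have "Re (herm z z) * Re (herm w w) \<le> 0"
    using assms by (simp add: mult_nonpos_nonneg)
  then show ?thesis
    by (rule order_trans) simp
next
  case True
  define g where "g = sqrt ((cmod (z $ 1))\<^sup>2 + (cmod (z $ 2))\<^sup>2)"
  define d where "d = sqrt ((cmod (w $ 1))\<^sup>2 + (cmod (w $ 2))\<^sup>2)"
  define a where "a = cmod (z $ 3)"
  define b where "b = cmod (w $ 3)"
  have gd: "g \<ge> 0" "d \<ge> 0" "a \<ge> 0" "b \<ge> 0"
    by (auto simp: g_def d_def a_def b_def)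
  have qz: "Re (herm z z) = g\<^sup>2 - a\<^sup>2" and qw: "Re (herm w w) = d\<^sup>2 - b\<^sup>2"
    by (simp_all add: Re_herm_self g_def d_def a_def b_def)
  have "g < a" "d < b"
    using assms True gd unfolding qz qw by (auto simp: power2_less_imp_less)
  then have le: "g * d \<le> a * b"
    using gd by (intro mult_mono) auto
  have CS: "(a * b + c * d)\<^sup>2 \<le> (a\<^sup>2 + c\<^sup>2) * (b\<^sup>2 + d\<^sup>2)" for a b c d :: real
    using zero_le_power2[of "a * d - c * b"] by (simp add: power2_eq_square algebra_simps)
  have "(cmod (z $ 1) * cmod (w $ 1) + cmod (z $ 2) * cmod (w $ 2))\<^sup>2 \<le> (g * d)\<^sup>2"
    using CS[of "cmod (z $ 1)" "cmod (w $ 1)" "cmod (z $ 2)" "cmod (w $ 2)"]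
    unfolding g_def d_def power_mult_distrib by simp
  then have "cmod (z $ 1) * cmod (w $ 1) + cmod (z $ 2) * cmod (w $ 2) \<le> g * d"
    by (rule power2_le_imp_le) (simp add: gd)
  then have "cmod (z $ 1 * cnj (w $ 1) + z $ 2 * cnj (w $ 2)) \<le> g * d"
    by (intro order_trans[OF norm_triangle_ineq]) (simp add: norm_mult)
  moreover have "cmod (z $ 3 * cnj (w $ 3)) = a * b"
    by (simp add: norm_mult a_def b_def)
  ultimately have "a * b - g * d \<le> cmod (herm z w)"
    unfolding herm_def
    using norm_triangle_ineq3[of "z $ 1 * cnj (w $ 1) + z $ 2 * cnj (w $ 2)" "z $ 3 * cnj (w $ 3)"] by linarith
  then have "(a * b - g * d)\<^sup>2 \<le> (cmod (herm z w))\<^sup>2"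
    using le by (intro power_mono) auto
  moreover have "(a * b - g * d)\<^sup>2 = (g\<^sup>2 - a\<^sup>2) * (d\<^sup>2 - b\<^sup>2) + (a * d - b * g)\<^sup>2"
    by (simp add: power2_eq_square algebra_simps)
  ultimately show ?thesis
    using zero_le_power2[of "a * d - b * g"] unfolding qz qw by linarith
qed

lemma span_singleton_eq: "vec.span {z} = range (\<lambda>k. k *s z)" for z :: "complex ^ 3"
  by (rule vec.span_singleton)

lemma mem_span_singleton: "z \<in> vec.span {z}" for z :: "complex ^ 3"
  by (simp add: vec.span_base)

section \<open>Complex geodesics and their polar vectors\<close>

lemma line_mem_geodesic_iff:
  assumes "polar_vector c C" "z \<noteq> 0"
  shows "vec.span {z} \<in> C \<longleftrightarrow> herm c z = 0"
proof
  assume "vec.span {z} \<in> C"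
  then obtain y where "vec.span {z} = vec.span {y}" "herm c y = 0"
    using assms by (auto simp: polar_vector_def)
  then show "herm c z = 0"
    using mem_span_singleton[of z] by (auto simp: span_singleton_eq herm_simps)
next
  assume "herm c z = 0"
  then show "vec.span {z} \<in> C"
    using assms by (auto simp: polar_vector_def)
qed

lemma geodesic_Int_H2C:
  assumes "polar_vector c C"
  shows "C \<inter> H2C = {vec.span {z} | z. Re (herm z z) < 0 \<and> herm c z = 0}"
proof -
  have "z \<noteq> 0" if "Re (herm z z) < 0" for z
    using that by auto
  then show ?thesis
    using line_mem_geodesic_iff[OF assms] by (auto simp: H2C_def)
qed

text \<open>\<open>c\<close> and its orthogonal complement span the space; for the right
  \<open>k\<close>, \<open>c' - k *s c\<close> is orthogonal to both and vanishes by
  nondegeneracy.\<close>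

lemma polar_vector_unique:
  assumes "polar_vector c C" "polar_vector c' C"
  shows "\<exists>k. k \<noteq> 0 \<and> c' = k *s c"
proof -
  have c: "herm c c \<noteq> 0" and c': "herm c' c' \<noteq> 0"
    using assms by (auto simp: polar_vector_def)
  define k where "k = herm c' c / herm c c"
  have orth: "herm c' z = 0" if "herm c z = 0" for z
    using that line_mem_geodesic_iff[OF assms(1), of z] line_mem_geodesic_iff[OF assms(2), of z]
    by (cases "z = 0") auto
  have "herm (c' - k *s c) w = 0" for w
  proof -
    define r where "r = herm w c / herm c c"
    have "herm c (w - r *s c) = 0"
      using c cnj_herm[of c c] cnj_herm[of w c] by (simp add: herm_simps r_def field_simps)
    moreover from this have "herm c' (w - r *s c) = 0"
      by (rule orth)
    moreover have "herm (c' - k *s c) c = 0"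
      using c by (simp add: herm_simps k_def)
    ultimately show ?thesis
      by (simp add: herm_simps)
  qed
  then have "c' - k *s c = 0"
    by (rule herm_nondegenerate)
  then have "c' = k *s c"
    by simp
  moreover from this c' have "k \<noteq> 0"
    by (auto simp: herm_simps)
  ultimately show ?thesis
    by blast
qed

text \<open>The Hermitian cross product \<open>v\<close> of the polar vectors satisfies <v,v> =
  |<c,c'>|^2 - 1. A modulus below 1 would make \<open>v\<close> negative, and its line a common
  point of the geodesics in \<open>H2C\<close>.\<close>

lemma cmod_herm_geodesic_ge_1:
  assumes "normalised_polar_vector c C" "normalised_polar_vector c' C'" "C \<inter> C' \<inter> H2C = {}"
  shows "1 \<le> cmod (herm c c')"
proof -
  have c: "herm c c = 1" "herm c' c' = 1" "polar_vector c C" "polar_vector c' C'"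
    using assms by (auto simp: normalised_polar_vector_def)
  define v :: "complex ^ 3" where "v = vector [cnj (c $ 2 * c' $ 3 - c $ 3 * c' $ 2),
    cnj (c $ 3 * c' $ 1 - c $ 1 * c' $ 3), - cnj (c $ 1 * c' $ 2 - c $ 2 * c' $ 1)]"
  have v: "herm c v = 0" "herm c' v = 0"
    by (simp_all add: herm_def v_def algebra_simps)
  have "herm v v = herm c c' * herm c' c - herm c c * herm c' c'"
    by (simp add: herm_def v_def algebra_simps)
  also have "\<dots> = of_real ((cmod (herm c c'))\<^sup>2 - 1)"
    by (simp add: herm_mult_swap c)
  finally have "Re (herm v v) = (cmod (herm c c'))\<^sup>2 - 1"
    by simp
  moreover have "\<not> Re (herm v v) < 0"
  proof
    assume "Re (herm v v) < 0"
    then have "vec.span {v} \<in> C \<inter> C' \<inter> H2C"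
      using v geodesic_Int_H2C[OF c(3)] geodesic_Int_H2C[OF c(4)] by blast
    with assms(3) show False
      by blast
  qed
  ultimately have "1\<^sup>2 \<le> (cmod (herm c c'))\<^sup>2"
    by simp
  then show ?thesis
    by (rule power2_le_imp_le) simp
qed

text \<open>Resolves the definite description: the ratio does not depend on the representatives and
  is at least 1 by \<open>reverse_Cauchy_Schwarz\<close>, so exactly one nonnegative
  \<open>r\<close> fits.\<close>

lemma cosh_bergman_dist:
  assumes z: "Re (herm z z) < 0" and w: "Re (herm w w) < 0"
  defines "r \<equiv> bergman_dist (vec.span {z}) (vec.span {w})"
  shows "0 \<le> r" and "(cosh (r / 2))\<^sup>2 * (Re (herm z z) * Re (herm w w)) = (cmod (herm z w))\<^sup>2"
proof -
  define \<rho> where "\<rho> = (cmod (herm z w))\<^sup>2 / (Re (herm z z) * Re (herm w w))"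
  have pos: "Re (herm z z) * Re (herm w w) > 0"
    using z w by (simp add: mult_neg_neg)
  have \<rho>: "1 \<le> \<rho>"
    using reverse_Cauchy_Schwarz[OF z] pos by (simp add: \<rho>_def)
  have ratio: "herm x y * herm y x / (herm x x * herm y y) = of_real \<rho>"
    if x: "x \<in> vec.span {z} - {0}" and y: "y \<in> vec.span {w} - {0}" for x y
  proof -
    obtain k l where kl: "x = k *s z" "y = l *s w" "k \<noteq> 0" "l \<noteq> 0"
      using x y by (auto simp: span_singleton_eq)
    have "herm x y * herm y x / (herm x x * herm y y) = herm z w * herm w z / (herm z z * herm w w)"
      using kl by (simp add: herm_simps)
    also have "\<dots> = of_real \<rho>"
      by (subst herm_self_real[of z], subst herm_self_real[of w]) (simp add: herm_mult_swap \<rho>_def)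
    finally show ?thesis .
  qed
  have z0: "z \<in> vec.span {z} - {0}" and w0: "w \<in> vec.span {w} - {0}"
    using z w by (auto simp: mem_span_singleton)
  have iff: "0 \<le> r \<and> (\<forall>x \<in> vec.span {z} - {0}. \<forall>y \<in> vec.span {w} - {0}.
      complex_of_real ((cosh (r / 2))\<^sup>2) = (herm x y * herm y x) / (herm x x * herm y y)) \<longleftrightarrow>
      r = 2 * arcosh (sqrt \<rho>)" (is "?P r \<longleftrightarrow> _") for r
  proof
    assume P: "?P r"
    then have "complex_of_real ((cosh (r / 2))\<^sup>2) = of_real \<rho>"
      using z0 w0 ratio[OF z0 w0] by metis
    then have "(cosh (r / 2))\<^sup>2 = \<rho>"
      by (simp only: of_real_eq_iff)
    then have "sqrt \<rho> = cosh (r / 2)"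
      by (intro real_sqrt_unique) auto
    then show "r = 2 * arcosh (sqrt \<rho>)"
      using P by (simp add: arcosh_cosh_real)
  next
    assume r: "r = 2 * arcosh (sqrt \<rho>)"
    then have "(cosh (r / 2))\<^sup>2 = \<rho>"
      using \<rho> by (simp add: cosh_arcosh_real)
    then show "?P r"
      using ratio r \<rho> by (auto simp: arcosh_nonneg_real)
  qed
  have r: "r = 2 * arcosh (sqrt \<rho>)"
    unfolding r_def bergman_dist_def by (simp only: iff the_eq_trivial)
  then show "0 \<le> r"
    using \<rho> by (simp add: arcosh_nonneg_real)
  have "(cosh (r / 2))\<^sup>2 = \<rho>"
    using \<rho> r by (simp add: cosh_arcosh_real)
  then show "(cosh (r / 2))\<^sup>2 * (Re (herm z z) * Re (herm w w)) = (cmod (herm z w))\<^sup>2"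
    using nonzero_divide_eq_eq[of "Re (herm z z) * Re (herm w w)" "(cmod (herm z w))\<^sup>2" \<rho>] pos
    by (simp only: \<rho>_def) auto
qed

lemma cosh_half_square_le_iff:
  assumes "0 \<le> x" "0 \<le> y"
  shows "(cosh (x / 2))\<^sup>2 \<le> (cosh (y / 2))\<^sup>2 \<longleftrightarrow> x \<le> (y::real)"
proof -
  have "(cosh (x / 2))\<^sup>2 \<le> (cosh (y / 2))\<^sup>2 \<longleftrightarrow> cosh (x / 2) \<le> cosh (y / 2)"
    by (intro iffI power_mono) (auto intro: power2_le_imp_le cosh_real_nonneg)
  also have "\<dots> \<longleftrightarrow> x \<le> y"
    using assms by (simp add: cosh_real_nonneg_le_iff)
  finally show ?thesis .
qed

text \<open>Two uses of the reversed Cauchy-Schwarz inequality: \<open>w\<close> against the part of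
  \<open>c\<close> orthogonal to \<open>c'\<close> bounds |<w,c>|, and \<open>z\<close> against the
  projection of \<open>w\<close> to the complement of \<open>c\<close> bounds |<z,w>|.\<close>

lemma herm_geodesics_lower_bound:
  assumes c: "herm c c = 1" "herm c' c' = 1"
    and z: "Re (herm z z) < 0" "herm c z = 0" and w: "Re (herm w w) < 0" "herm c' w = 0"
  shows "(cmod (herm c c'))\<^sup>2 * (Re (herm z z) * Re (herm w w)) \<le> (cmod (herm z w))\<^sup>2"
proof -
  define a where "a = herm c c'"
  have z': "herm z c = 0" and w': "herm w c' = 0"
    using z w by (metis cnj_herm complex_cnj_zero)+
  have "herm (w - herm w c *s c) (w - herm w c *s c) = herm w w - herm w c * herm c w"
    by (simp add: herm_simps c cnj_herm)
  then have 1: "Re (herm (w - herm w c *s c) (w - herm w c *s c)) = Re (herm w w) - (cmod (herm w c))\<^sup>2"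
    by (simp add: herm_mult_swap)
  have "herm (c - a *s c') (c - a *s c') = 1 - a * cnj a"
    by (simp add: herm_simps c a_def cnj_herm)
  then have 2: "Re (herm (c - a *s c') (c - a *s c')) = 1 - (cmod a)\<^sup>2"
    by (simp add: complex_norm_square[symmetric])
  have "Re (herm w w) * (1 - (cmod a)\<^sup>2) \<le> (cmod (herm w c))\<^sup>2"
    using reverse_Cauchy_Schwarz[OF w(1), of "c - a *s c'"] unfolding 2 by (simp add: herm_simps w')
  then have "Re (herm w w) - (cmod (herm w c))\<^sup>2 \<le> (cmod a)\<^sup>2 * Re (herm w w)"
    by (simp add: algebra_simps)
  then have "Re (herm z z) * ((cmod a)\<^sup>2 * Re (herm w w)) \<le> Re (herm z z) * (Re (herm w w) - (cmod (herm w c))\<^sup>2)"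
    using z by (intro mult_left_mono_neg) auto
  also have "\<dots> \<le> (cmod (herm z w))\<^sup>2"
    using reverse_Cauchy_Schwarz[OF z(1), of "w - herm w c *s c"] unfolding 1 by (simp add: herm_simps z')
  finally show ?thesis
    by (simp add: a_def mult_ac)
qed

text \<open>The infimum is attained at the projections of the polar vectors if \<open>|\<langle>c,c'\<rangle>| > 1\<close>. If the modulus is 1,
  the projection is null and has to be perturbed by a multiple of a negative vector.\<close>

lemma herm_geodesics_approximation:
  assumes c: "herm c c = 1" "herm c' c' = 1" and a: "1 \<le> cmod (herm c c')" and \<eta>: "0 < \<eta>"
  shows "\<exists>z w. Re (herm z z) < 0 \<and> herm c z = 0 \<and> Re (herm w w) < 0 \<and> herm c' w = 0 \<and>
    (cmod (herm z w))\<^sup>2 < ((cmod (herm c c'))\<^sup>2 + \<eta>) * (Re (herm z z) * Re (herm w w))"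
proof -
  define e where "e = (cmod (herm c c'))\<^sup>2 - 1"
  have e: "0 \<le> e"
    using a by (simp add: e_def)
  define d where "d = c - herm c c' *s c'"
  have dc': "herm d c' = 0" and c'd: "herm c' d = 0"
    by (simp_all add: d_def herm_simps c cnj_herm)
  have dd: "herm d d = of_real (- e)"
    using complex_norm_square[of "herm c c'"] by (simp add: d_def e_def herm_simps c cnj_herm)
  define v0 :: "complex ^ 3" where "v0 = axis 3 1 - herm (axis 3 1) c' *s c'"
  have v0c': "herm c' v0 = 0"
    by (simp add: v0_def herm_simps c cnj_herm)
  have "herm (axis 3 1 :: complex ^ 3) (axis 3 1) = -1"
    by (simp add: herm_def axis_def)
  then have "herm v0 v0 = - 1 - of_real ((cmod (herm (axis 3 1) c'))\<^sup>2)"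
    by (simp add: v0_def herm_simps c cnj_herm herm_mult_swap)
  then have v0v0: "Re (herm v0 v0) < 0"
    using zero_le_power2[of "cmod (herm (axis 3 1) c')"] by (simp only: minus_complex.sel uminus_complex.sel one_complex.sel Re_complex_of_real)
  define m where "m = - Re (herm v0 v0)"
  have m: "0 < m" "herm v0 v0 = of_real (- m)"
    using v0v0 herm_self_real[of v0] by (auto simp: m_def)
  \<comment> \<open>The phase makes \<open>herm d v\<close> real and nonpositive, so that the
    perturbation can only push \<open>herm w w\<close> further down. If the product is 0 any phase
    will do, but \<open>sgn 0\<close> is not unimodular.\<close>
  define u where "u = (if herm d v0 = 0 then 1 else - sgn (herm d v0))"
  have u: "cmod u = 1"
    by (simp add: u_def norm_sgn)
  define v where "v = u *s v0"
  define k where "k = cmod (herm d v0)"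
  have dv: "herm d v = of_real (- k)"
  proof (cases "herm d v0 = 0")
    case False
    have "cnj (herm d v0) * herm d v0 = of_real k * of_real k"
      using complex_norm_square[of "herm d v0"] by (simp add: k_def power2_eq_square mult.commute)
    moreover have "herm d v = - (cnj (herm d v0) * herm d v0) / of_real k"
      using False by (simp add: v_def herm_simps u_def sgn_eq k_def)
    ultimately show ?thesis
      using False by (simp add: k_def)
  qed (simp add: v_def herm_simps k_def)
  have vd: "herm v d = of_real (- k)"
    using cnj_herm[of d v] dv by simp
  have vv: "herm v v = of_real (- m)"
  proof -
    have "herm v v = (cnj u * u) * herm v0 v0"
      by (simp add: v_def herm_simps)
    then show ?thesis
      using u by (simp add: cnj_mult_unit m)
  qed
  \<comment> \<open>\<open>\<epsilon> * k \<le> \<eta>\<close> lets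
    \<open>\<eta> * (\<epsilon> * k)\<close> absorb the square of \<open>\<epsilon> * k\<close>; the
    summand 1 covers \<open>k = 0\<close>.\<close>
  define \<epsilon> where "\<epsilon> = \<eta> / (k + 1)"
  have k: "0 \<le> k"
    by (simp add: k_def)
  have \<epsilon>: "0 < \<epsilon>" "\<epsilon> * k \<le> \<eta>"
    using k \<eta> by (auto simp: \<epsilon>_def field_simps)
  define w where "w = d + of_real \<epsilon> *s v"
  define s where "s = e + 2 * \<epsilon> * k + \<epsilon>\<^sup>2 * m"
  have s: "0 < s"
    using e k \<epsilon> m by (simp add: s_def add_nonneg_pos)
  have ww: "herm w w = of_real (- s)"
    by (simp add: w_def herm_simps dd dv vd vv s_def power2_eq_square algebra_simps)
  have wc': "herm c' w = 0"
    by (simp add: w_def herm_simps c'd v_def v0c')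
  have w'c: "herm w c' = 0"
    using wc' by (metis cnj_herm complex_cnj_zero)
  have "herm w c = herm w d"
    by (simp add: d_def herm_simps w'c)
  also have "\<dots> = of_real (- (e + \<epsilon> * k))"
    by (simp add: w_def herm_simps dd vd)
  finally have wc: "herm w c = of_real (- (e + \<epsilon> * k))" .
  then have cw: "herm c w = of_real (- (e + \<epsilon> * k))"
    using cnj_herm[of w c] by simp
  define z where "z = w - herm w c *s c"
  have cz: "herm c z = 0"
    by (simp add: z_def herm_simps c cnj_herm)
  have zw: "herm z w = of_real (- (s + (e + \<epsilon> * k)\<^sup>2))"
    by (simp add: z_def herm_simps ww wc cw power2_eq_square algebra_simps)
  have zz: "herm z z = of_real (- (s + (e + \<epsilon> * k)\<^sup>2))"
    by (simp add: z_def herm_simps ww wc cw c power2_eq_square algebra_simps)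
  have "(\<epsilon> * k) * (\<epsilon> * k) \<le> \<eta> * (\<epsilon> * k)"
    using \<epsilon> k by (intro mult_right_mono) auto
  moreover have "0 \<le> \<eta> * e" "0 < \<eta> * (\<epsilon>\<^sup>2 * m)" "0 \<le> e * (\<epsilon>\<^sup>2 * m)" "0 \<le> \<eta> * (\<epsilon> * k)"
    using e \<eta> \<epsilon> m k by auto
  ultimately have F: "(e + \<epsilon> * k)\<^sup>2 < (e + \<eta>) * s"
    unfolding s_def by (simp add: power2_eq_square algebra_simps)
  \<comment> \<open>As \<open>z\<close> is the projection of \<open>w\<close>, both
    \<open>herm z w\<close> and \<open>herm z z\<close> equal \<open>- S\<close>, and the claim
    reduces to \<open>S < (1 + e + \<eta>) * s\<close>.\<close>
  define S where "S = s + (e + \<epsilon> * k)\<^sup>2"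
  have S: "0 < S" "S < (1 + e + \<eta>) * s"
    using s F by (auto simp: S_def add_pos_nonneg algebra_simps)
  have "S * S < ((1 + e + \<eta>) * s) * S"
    using S by (intro mult_strict_right_mono) auto
  then have "(cmod (herm z w))\<^sup>2 < ((cmod (herm c c'))\<^sup>2 + \<eta>) * (Re (herm z z) * Re (herm w w))"
    unfolding zw zz ww S_def[symmetric] norm_of_real Re_complex_of_real
    by (simp add: e_def power2_eq_square mult_ac)
  moreover have "Re (herm z z) < 0" "Re (herm w w) < 0"
    using S s unfolding zz ww S_def[symmetric] by simp_all
  ultimately show ?thesis
    using cz wc' by blast
qed

text \<open>\<open>herm_geodesics_lower_bound\<close> bounds all distances between points of the two
  geodesics from below, and \<open>herm_geodesics_approximation\<close> shows that no larger bound
  holds.\<close>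

lemma cosh_geodesic_dist:
  assumes C: "normalised_polar_vector c C" and C': "normalised_polar_vector c' C'"
    and disj: "C \<inter> C' \<inter> H2C = {}"
  shows "cosh (geodesic_dist C C' / 2) = cmod (herm c c')"
proof -
  have c: "herm c c = 1" "herm c' c' = 1" "polar_vector c C" "polar_vector c' C'"
    using assms by (auto simp: normalised_polar_vector_def)
  note a = cmod_herm_geodesic_ge_1[OF assms]
  define d where "d = 2 * arcosh (cmod (herm c c'))"
  have d: "0 \<le> d" "cosh (d / 2) = cmod (herm c c')"
    using a by (auto simp: d_def arcosh_nonneg_real cosh_arcosh_real)
  have "geodesic_dist C C' = d"
    unfolding geodesic_dist_def
  proof (rule cInf_eq)
    fix x assume "x \<in> (\<lambda>(p, q). bergman_dist p q) ` ((C \<inter> H2C) \<times> (C' \<inter> H2C))"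
    then obtain z w where zw: "Re (herm z z) < 0" "herm c z = 0" "Re (herm w w) < 0" "herm c' w = 0"
      and x: "x = bergman_dist (vec.span {z}) (vec.span {w})"
      using geodesic_Int_H2C[OF c(3)] geodesic_Int_H2C[OF c(4)] by auto
    have pos: "Re (herm z z) * Re (herm w w) > 0"
      using zw by (simp add: mult_neg_neg)
    have "(cosh (d / 2))\<^sup>2 * (Re (herm z z) * Re (herm w w)) \<le> (cosh (x / 2))\<^sup>2 * (Re (herm z z) * Re (herm w w))"
      using herm_geodesics_lower_bound[OF c(1,2) zw] cosh_bergman_dist(2)[OF zw(1,3)] d x by simp
    then have "(cosh (d / 2))\<^sup>2 \<le> (cosh (x / 2))\<^sup>2"
      using pos by (rule mult_right_le_imp_le)
    then show "d \<le> x"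
      using cosh_half_square_le_iff[of d x] d cosh_bergman_dist(1)[OF zw(1,3)] x by simp
  next
    fix y assume y: "\<And>x. x \<in> (\<lambda>(p, q). bergman_dist p q) ` ((C \<inter> H2C) \<times> (C' \<inter> H2C)) \<Longrightarrow> y \<le> x"
    show "y \<le> d"
    proof (rule ccontr)
      assume "\<not> y \<le> d"
      then have "(cosh (d / 2))\<^sup>2 < (cosh (y / 2))\<^sup>2"
        using cosh_half_square_le_iff[of y d] d(1) by (metis less_le_not_le nle_le order.trans)
      then obtain z w where zw: "Re (herm z z) < 0" "herm c z = 0" "Re (herm w w) < 0" "herm c' w = 0"
        and less: "(cmod (herm z w))\<^sup>2 < (cosh (y / 2))\<^sup>2 * (Re (herm z z) * Re (herm w w))"
        using herm_geodesics_approximation[OF c(1,2) a, of "(cosh (y / 2))\<^sup>2 - (cosh (d / 2))\<^sup>2"] d by auto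
      define x where "x = bergman_dist (vec.span {z}) (vec.span {w})"
      have pos: "Re (herm z z) * Re (herm w w) > 0"
        using zw by (simp add: mult_neg_neg)
      have "(cosh (x / 2))\<^sup>2 * (Re (herm z z) * Re (herm w w)) < (cosh (y / 2))\<^sup>2 * (Re (herm z z) * Re (herm w w))"
        using less cosh_bergman_dist(2)[OF zw(1,3)] by (simp add: x_def)
      then have "(cosh (x / 2))\<^sup>2 < (cosh (y / 2))\<^sup>2"
        using pos by (simp only: mult_less_cancel_right_pos)
      moreover have "vec.span {z} \<in> C \<inter> H2C" "vec.span {w} \<in> C' \<inter> H2C"
        using zw geodesic_Int_H2C[OF c(3)] geodesic_Int_H2C[OF c(4)] by auto
      then have "y \<le> x"
        unfolding x_def by (intro y) auto
      moreover have "0 \<le> y" "0 \<le> x"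
        using \<open>\<not> y \<le> d\<close> d cosh_bergman_dist(1)[OF zw(1,3)] by (auto simp: x_def)
      ultimately show False
        using cosh_half_square_le_iff[of y x] by linarith
    qed
  qed
  with d show ?thesis
    by simp
qed

section \<open>Shimizu's lemma and Hecke groups\<close>

lemma linear_vecI:
  fixes f :: "complex ^ 'n \<Rightarrow> complex ^ 'n"
  assumes "\<And>x y. f (x + y) = f x + f y" "\<And>k x. f (k *s x) = k *s f x"
  shows "Vector_Spaces.linear (*s) (*s) f"
  using assms by (simp add: Vector_Spaces.linear_iff vec.vector_space_axioms)

text \<open>A complex reflection if \<open>herm v v = 1\<close>, a vertical Heisenberg translation if \<open>v\<close> is null and \<open>d\<close> is
  imaginary.\<close>

definition pert :: "complex \<Rightarrow> complex ^ 3 \<Rightarrow> complex ^ 3 ^ 3" where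
  "pert d v = matrix (\<lambda>z. z + (d * herm z v) *s v)"

lemma pert_apply: "pert d v *v z = z + (d * herm z v) *s v"
  unfolding pert_def
  by (rule matrix_works, rule linear_vecI)
     (simp_all add: herm_simps algebra_simps vec_eq_iff)

text \<open>Conjugation keeps the shape and only moves the vector, so conjugates in a subgroup can
  be followed by following vectors.\<close>

lemma pert_conj:
  assumes "A \<in> carrier U21"
  shows "A ** pert d v = pert d (A *v v) ** A"
  using assms
  by (simp add: matrix_eq pert_apply U21_herm matrix_vector_right_distrib vector_scalar_commute
      flip: matrix_vector_mul_assoc)

lemma pert_unit_scale:
  assumes "cmod u = 1"
  shows "pert d (u *s v) = pert d v"
proof -
  have "d * (cnj u * herm z v) * u = d * herm z v" for z
    using cnj_mult_unit[OF assms] by (simp add: mult.assoc mult.left_commute[of _ u] mult.commute[of u])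
  then show ?thesis
    by (simp add: matrix_eq pert_apply herm_simps vec_eq_iff mult.assoc[symmetric])
qed

lemma pert_in_U21:
  assumes "herm v v = 1" "cmod (1 + d) = 1"
  shows "pert d v \<in> carrier U21"
proof -
  have d: "d + cnj d + d * cnj d = 0"
    using cnj_mult_unit[OF assms(2)] by (simp add: algebra_simps)
  have "herm (pert d v *v z) (pert d v *v w) = herm z w + (d + cnj d + d * cnj d) * herm z v * herm v w" for z w
    by (simp add: pert_apply herm_simps assms(1) cnj_herm algebra_simps)
  with d show ?thesis
    by (simp add: U21_carrier_iff)
qed

lemma tendsto_pert:
  assumes "(v \<longlongrightarrow> p) F"
  shows "((\<lambda>n. pert d (v n)) \<longlongrightarrow> pert d p) F"
  unfolding pert_def matrix_def herm_def
  by (intro vec_tendstoI) (auto intro!: tendsto_intros assms)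

lemma norm_vector_scale: "norm (k *s v) = cmod k * norm v" for v :: "complex ^ 'n"
  by (simp add: norm_vec_def norm_mult L2_set_right_distrib)

text \<open>Tested on \<open>p\<close>: as \<open>pert d p\<close> fixes this null vector, equality
  up to a scalar would make the image of \<open>p\<close> under \<open>pert d v\<close> orthogonal
  to \<open>p\<close>, but their product is \<open>d\<close> times |<p,v>|^2.\<close>

lemma proj_class_pert_neq:
  assumes "herm p p = 0" "herm v p \<noteq> 0" "d \<noteq> 0" "pert d v \<in> carrier U21"
  shows "proj_class (pert d v) \<noteq> proj_class (pert d p)"
proof
  assume "proj_class (pert d v) = proj_class (pert d p)"
  then obtain u where "pert d v = mat u ** pert d p"
    using proj_class_eq_imp assms(4) by blast
  then have "pert d v *v p = u *s (pert d p *v p)"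
    by (simp add: mat_mult_vector flip: matrix_vector_mul_assoc)
  then have "herm (p + (d * herm p v) *s v) p = u * herm p p"
    using assms(1) by (simp add: pert_apply herm_simps)
  then have "d * herm p v * herm v p = 0"
    by (simp add: herm_simps assms(1))
  with assms(2,3) show False
    using cnj_herm[of v p] by auto
qed

section \<open>Subgroups of PU(2,1) and Shimizu's lemma\<close>

locale PU21_subgroup =
  fixes \<Gamma>
  assumes subgroup: "subgroup \<Gamma> PU21"
begin

lemma lift_carrier: "A \<in> lift \<Gamma> \<Longrightarrow> A \<in> carrier U21"
  by (simp add: lift_def)

lemma lift_mult: "A \<in> lift \<Gamma> \<Longrightarrow> B \<in> lift \<Gamma> \<Longrightarrow> A ** B \<in> lift \<Gamma>"
  using subgroup.m_closed[OF subgroup_lift[OF subgroup]] by simp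

lemma lift_one: "mat 1 \<in> lift \<Gamma>"
  using subgroup.one_closed[OF subgroup_lift[OF subgroup]] by simp

lemma lift_inv: "A \<in> lift \<Gamma> \<Longrightarrow> inv\<^bsub>U21\<^esub> A \<in> lift \<Gamma>"
  using subgroup.m_inv_closed[OF subgroup_lift[OF subgroup]] by simp

lemma lift_pert_conj:
  assumes "A \<in> lift \<Gamma>" "pert d v \<in> lift \<Gamma>"
  shows "pert d (A *v v) \<in> lift \<Gamma>"
proof -
  have "A ** inv\<^bsub>U21\<^esub> A = mat 1"
    using U21.r_inv[OF lift_carrier[OF assms(1)]] by simp
  then have "A ** pert d v ** inv\<^bsub>U21\<^esub> A = pert d (A *v v)"
    by (simp add: pert_conj[OF lift_carrier[OF assms(1)]] flip: matrix_mul_assoc)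
  then show ?thesis
    using assms lift_mult lift_inv by metis
qed

text \<open>Iterate \<open>v \<mapsto> pert d v *v p\<close>, that is, replace the conjugate of \<open>T\<close> fixing \<open>v\<close> by the conjugate of \<open>T\<close>
  by it: the quantity below 1 is squared in each step, so the conjugates converge to \<open>T\<close>.\<close>

lemma Shimizu:
  assumes p: "herm p p = 0" and T: "pert d p \<in> lift \<Gamma>" and A: "A \<in> lift \<Gamma>"
    and pos: "0 < cmod d * cmod (herm (A *v p) p)" and less: "cmod d * cmod (herm (A *v p) p) < 1"
  shows "\<not> discrete_in_PU21 \<Gamma>"
proof -
  define v where "v = rec_nat (A *v p) (\<lambda>_ v. pert d v *v p)"
  have v0: "v 0 = A *v p" and vSuc: "v (Suc n) = p + (d * herm p (v n)) *s v n" for n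
    by (simp_all add: v_def pert_apply)
  define x where "x n = cmod d * cmod (herm (v n) p)" for n
  have v_in: "pert d (v n) \<in> lift \<Gamma>" for n
  proof (induction n)
    case 0
    show ?case
      using lift_pert_conj[OF A T] by (simp add: v0)
  next
    case (Suc n)
    show ?case
      using lift_pert_conj[OF Suc T] by (simp add: v_def)
  qed
  have x_Suc: "x (Suc n) = (x n)\<^sup>2" for n
    using cmod_herm_commute[of p "v n"]
    by (simp add: x_def vSuc herm_simps p norm_mult power2_eq_square)
  have x0: "0 < x 0" "x 0 < 1"
    using pos less by (simp_all add: x_def v0)
  \<comment> \<open>Weaker than what the squaring gives, but geometric decay suffices for the limit.
    Positivity keeps the classes of the conjugates different from that of the limit.\<close>
  have x_bounds: "0 < x n \<and> x n \<le> x 0 ^ Suc n" for n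
  proof (induction n)
    case (Suc n)
    have "x n \<le> x 0"
      using Suc power_Suc_le_self[of "x 0" n] x0 by linarith
    then have "x n * x n \<le> x 0 ^ Suc n * x 0"
      using Suc x0 by (intro mult_mono) auto
    with Suc show ?case
      by (simp add: x_Suc power2_eq_square mult.commute)
  qed (use x0 in simp)
  have x_le: "x n \<le> x 0" for n
    using x_bounds[of n] x0 power_Suc_le_self[of "x 0" n] by linarith
  \<comment> \<open>Chosen so that \<open>norm p + x 0 * M \<le> M\<close>: the bound reproduces
    itself under the iteration.\<close>
  define M where "M = norm (v 0) + norm p / (1 - x 0)"
  have step: "norm (v (Suc n) - p) = x n * norm (v n)" for n
    using cmod_herm_commute[of p "v n"] by (simp add: vSuc norm_vector_scale norm_mult x_def)
  have M: "norm (v n) \<le> M" for n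
  proof (induction n)
    case 0
    show ?case
      using x0 by (simp add: M_def)
  next
    case (Suc n)
    have "norm (v (Suc n)) \<le> norm p + x n * norm (v n)"
      using norm_triangle_ineq[of p "v (Suc n) - p"] step[of n] by simp
    also have "\<dots> \<le> norm p + x 0 * M"
      using Suc x_bounds[of n] x_le[of n] x0 by (intro add_left_mono mult_mono) auto
    also have "\<dots> \<le> M"
    proof -
      have "(1 - x 0) * M = (1 - x 0) * norm (v 0) + norm p"
        using x0 by (simp add: M_def distrib_left)
      moreover have "0 \<le> (1 - x 0) * norm (v 0)"
        using x0 by simp
      ultimately show ?thesis
        by (simp add: algebra_simps)
    qed
    finally show ?case .
  qed
  have "(\<lambda>n. v (Suc n)) \<longlonglongrightarrow> p"
  proof (rule LIM_zero_cancel, rule Lim_null_comparison)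
    have "norm (v (Suc n) - p) \<le> x 0 ^ Suc n * M" for n
      unfolding step using x_bounds[of n] M[of n] by (intro mult_mono) auto
    then show "\<forall>\<^sub>F n in sequentially. norm (v (Suc n) - p) \<le> x 0 ^ Suc n * M"
      by (intro always_eventually allI)
    show "(\<lambda>n. x 0 ^ Suc n * M) \<longlonglongrightarrow> 0"
      by (rule tendsto_mult_left_zero[OF LIMSEQ_Suc[OF LIMSEQ_realpow_zero[OF less_imp_le[OF x0(1)] x0(2)]]])
  qed
  then have lim: "(\<lambda>n. pert d (v (Suc n))) \<longlonglongrightarrow> pert d p"
    by (rule tendsto_pert)
  have "d \<noteq> 0"
    using pos by auto
  then have "proj_class (pert d (v (Suc n))) \<noteq> proj_class (pert d p)" for n
    using x_bounds[of "Suc n"] by (intro proj_class_pert_neq p lift_carrier v_in) (auto simp: x_def)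
  then show ?thesis
    using not_discrete_if_accumulation[OF v_in T lim] by blast
qed

text \<open>\<open>Shimizu\<close> for \<open>pert e c'\<close> flanked by two copies of
  \<open>pert (-2) c\<close>. The latter is self-adjoint for the form because -2 is real, which
  turns <h p,p> into the product of \<open>pert e c' *v q\<close> with the null vector
  \<open>q\<close>; only \<open>e\<close> times |<q,c'>|^2 survives.\<close>

lemma Shimizu_reflected:
  assumes p: "herm p p = 0" and T: "pert d p \<in> lift \<Gamma>" and R: "pert (-2) c \<in> lift \<Gamma>"
    and E: "pert e c' \<in> lift \<Gamma>" and pc': "herm p c' = 0"
  defines "r \<equiv> 4 * cmod d * cmod e * (cmod (herm p c))\<^sup>2 * (cmod (herm c' c))\<^sup>2"
  assumes pos: "0 < r" and less: "r < 1"
  shows "\<not> discrete_in_PU21 \<Gamma>"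
proof -
  define q where "q = pert (-2) c *v p"
  have RR: "herm (pert (-2) c *v x) y = herm x (pert (-2) c *v y)" for x y
    by (simp add: pert_apply herm_simps cnj_herm)
  have qq: "herm q q = 0"
    using U21_herm[OF lift_carrier[OF R], of p p] p by (simp add: q_def)
  have qc': "herm q c' = - 2 * herm p c * herm c c'"
    by (simp add: q_def pert_apply herm_simps pc')
  have "herm ((pert (-2) c ** pert e c' ** pert (-2) c) *v p) p = herm (q + (e * herm q c') *s c') q"
    by (simp add: RR q_def pert_apply[of e] flip: matrix_vector_mul_assoc)
  also have "\<dots> = e * (herm q c' * herm c' q)"
    by (simp add: herm_simps qq)
  also have "\<dots> = e * of_real ((cmod (herm q c'))\<^sup>2)"
    by (simp only: herm_mult_swap)
  finally have "cmod d * cmod (herm ((pert (-2) c ** pert e c' ** pert (-2) c) *v p) p) = r"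
    using cmod_herm_commute[of c c'] by (simp add: r_def norm_mult norm_power qc' power_mult_distrib)
  then show ?thesis
    using Shimizu[OF p T lift_mult[OF lift_mult[OF R E] R]] pos less by simp
qed

text \<open>In the coordinates of \<open>p\<close> and \<open>q\<close>, the translation times the
  reflection is a 2x2 matrix with eigenvalues -i exp(i\<theta>) and -i exp(-i\<theta>). The
  coefficients of its powers obey a Chebyshev recurrence, solved by \<open>Y\<close>.\<close>

lemma Hecke_word:
  fixes \<theta> t :: real
  assumes p: "herm p p = 0" and T: "pert (\<i> * of_real t) p \<in> lift \<Gamma>"
    and R: "pert (-2) c \<in> lift \<Gamma>" and c: "herm c c = 1"
    and \<theta>: "2 * t * (cmod (herm p c))\<^sup>2 = 2 * cos \<theta>" "sin \<theta> \<noteq> 0"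
  defines "q \<equiv> pert (-2) c *v p"
  defines "Y \<equiv> \<lambda>k::nat. \<i> * (- \<i>) ^ k * of_real (sin (k * \<theta>) / sin \<theta>)"
  shows "\<exists>A\<in>lift \<Gamma>. A *v p = Y (Suc k) *s p + Y k *s q"
proof (induction k)
  case 0
  show ?case
    using \<theta>(2) by (intro bexI[OF _ lift_one]) (simp add: Y_def)
next
  case (Suc k)
  then obtain A where A: "A \<in> lift \<Gamma>" "A *v p = Y (Suc k) *s p + Y k *s q"
    by blast
  have Rq: "pert (-2) c *v q = p"
    by (simp add: q_def pert_apply herm_simps c vec_eq_iff)
  have "herm q p = - 2 * (herm p c * herm c p)"
    by (simp add: q_def pert_apply herm_simps p)
  also have "\<dots> = - 2 * of_real ((cmod (herm p c))\<^sup>2)"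
    by (simp only: herm_mult_swap)
  finally have "\<i> * of_real t * herm q p = - \<i> * of_real (2 * t * (cmod (herm p c))\<^sup>2)"
    by simp
  then have Tq: "pert (\<i> * of_real t) p *v q = q - (\<i> * of_real (2 * cos \<theta>)) *s p"
    unfolding pert_apply \<theta>(1) by (simp add: vec_eq_iff)
  have Tp: "pert (\<i> * of_real t) p *v p = p"
    by (simp add: pert_apply p)
  define S where "S j = sin (real j * \<theta>) / sin \<theta>" for j
  have "sin (real (k + 2) * \<theta>) + sin (real k * \<theta>) = 2 * cos \<theta> * sin (real (k + 1) * \<theta>)"
    using sin_add[of "real (k + 1) * \<theta>" \<theta>] sin_diff[of "real (k + 1) * \<theta>" \<theta>]
    by (simp add: algebra_simps)
  then have "sin (real (Suc (Suc k)) * \<theta>) = 2 * cos \<theta> * sin (real (Suc k) * \<theta>) - sin (real k * \<theta>)"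
    by (simp add: algebra_simps)
  then have S: "S (Suc (Suc k)) = 2 * cos \<theta> * S (Suc k) - S k"
    unfolding S_def by (simp only: diff_divide_distrib times_divide_eq_right)
  have Y: "Y k = Y (Suc (Suc k)) + \<i> * of_real (2 * cos \<theta>) * Y (Suc k)"
    unfolding Y_def S_def[symmetric] S by (simp add: algebra_simps)
  have "(pert (\<i> * of_real t) p ** pert (-2) c ** A) *v p = Y (Suc (Suc k)) *s p + Y (Suc k) *s q"
    by (simp add: A(2) matrix_vector_right_distrib vector_scalar_commute q_def[symmetric] Rq Tq Tp
        Y vec_eq_iff algebra_simps flip: matrix_vector_mul_assoc)
  then show ?case
    using lift_mult[OF lift_mult[OF T R] A(1)] by blast
qed

end

text \<open>The multiple of \<open>\<theta>\<close> closest to \<open>\<pi>\<close> is off by at most \<open>\<theta>/2\<close>.\<close>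

lemma small_multiple_angle:
  assumes \<theta>: "0 < \<theta>" "\<theta> < pi / 2" and ne: "\<And>q::nat. q \<ge> 1 \<Longrightarrow> \<theta> \<noteq> pi / real q"
  shows "\<exists>k::nat. 0 < \<bar>sin (k * \<theta>)\<bar> \<and> 2 * cos \<theta> * \<bar>sin (k * \<theta>)\<bar> < sin \<theta>"
proof -
  have small: "0 < sin \<phi> \<and> 2 * cos \<theta> * sin \<phi> < sin \<theta>" if "0 < \<phi>" "\<phi> \<le> \<theta> / 2" for \<phi>
  proof -
    have "sin \<phi> \<le> sin (\<theta> / 2)"
      using that \<theta> by (intro sin_monotone_2pi_le) auto
    then have "2 * cos \<theta> * sin \<phi> \<le> 2 * cos \<theta> * sin (\<theta> / 2)"
      using \<theta> cos_gt_zero[of \<theta>] by (intro mult_left_mono) auto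
    also have "\<dots> < 2 * cos (\<theta> / 2) * sin (\<theta> / 2)"
      using \<theta> by (intro mult_strict_right_mono mult_strict_left_mono cos_monotone_0_pi sin_gt_zero) auto
    also have "\<dots> = sin \<theta>"
      using sin_double[of "\<theta> / 2"] by simp
    finally show ?thesis
      using that \<theta> by (auto intro: sin_gt_zero)
  qed
  define n where "n = nat \<lfloor>pi / \<theta>\<rfloor>"
  have "0 \<le> pi / \<theta>"
    using \<theta> by simp
  then have "0 \<le> \<lfloor>pi / \<theta>\<rfloor>"
    by simp
  then have n_int: "real n = of_int \<lfloor>pi / \<theta>\<rfloor>"
    by (simp add: n_def)
  have "real n \<le> pi / \<theta>" "pi / \<theta> < real n + 1"
    unfolding n_int by linarith+
  then have n: "n * \<theta> \<le> pi" "pi < n * \<theta> + \<theta>"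
    using \<theta> by (auto simp: field_simps)
  then have "n \<ge> 1"
    using \<theta> by (cases n) auto
  then have "n * \<theta> \<noteq> pi"
    using ne[of n] \<theta> by (auto simp: field_simps)
  with n have n': "n * \<theta> < pi"
    by simp
  show ?thesis
  proof (cases "pi - n * \<theta> \<le> \<theta> / 2")
    case True
    then show ?thesis
      using small[of "pi - n * \<theta>"] n' by (intro exI[of _ n]) auto
  next
    case False
    have "sin (real (Suc n) * \<theta>) = - sin (n * \<theta> + \<theta> - pi)"
      by (simp add: algebra_simps)
    then show ?thesis
      using small[of "n * \<theta> + \<theta> - pi"] n False by (intro exI[of _ "Suc n"]) auto
  qed
qed

text \<open>With \<open>s = 2 * cos \<theta>\<close>, the words of \<open>Hecke_word\<close> give
  the quantity in \<open>Shimizu\<close> the value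
  \<open>s * \<bar>sin (k * \<theta>)\<bar> / sin \<theta>\<close>. Unless \<theta> has the form
  \<pi>/q, \<open>small_multiple_angle\<close> finds a \<open>k\<close> that puts it strictly
  between 0 and 1.\<close>

lemma (in PU21_subgroup) Hecke_discrete:
  assumes disc: "discrete_in_PU21 \<Gamma>"
    and p: "herm p p = 0" and T: "pert (\<i> * of_real t) p \<in> lift \<Gamma>"
    and R: "pert (-2) c \<in> lift \<Gamma>" and c: "herm c c = 1"
  defines "s \<equiv> 2 * t * (cmod (herm p c))\<^sup>2"
  assumes s: "0 < s" "s < 2"
  shows "\<exists>q::nat. q \<ge> 3 \<and> s = 2 * cos (pi / real q)"
proof -
  define \<theta> where "\<theta> = arccos (s / 2)"
  have cos: "s = 2 * cos \<theta>"
    using s by (simp add: \<theta>_def)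
  have \<theta>: "0 < \<theta>" "\<theta> < pi / 2"
    using s arccos_less_arccos[of 0 "s / 2"] arccos_less_arccos[of "s / 2" 1] by (auto simp: \<theta>_def)
  then have sin: "0 < sin \<theta>"
    by (intro sin_gt_zero) auto
  have "\<exists>q::nat. q \<ge> 1 \<and> \<theta> = pi / real q"
  proof (rule ccontr)
    assume "\<not> ?thesis"
    then obtain k :: nat where k: "0 < \<bar>sin (k * \<theta>)\<bar>" "2 * cos \<theta> * \<bar>sin (k * \<theta>)\<bar> < sin \<theta>"
      using small_multiple_angle[OF \<theta>] by blast
    define q where "q = pert (-2) c *v p"
    obtain A x where A: "A \<in> lift \<Gamma>"
      and Ap: "A *v p = x *s p + (\<i> * (- \<i>) ^ k * of_real (sin (k * \<theta>) / sin \<theta>)) *s q"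
      using Hecke_word[OF p T R c, of \<theta> k] cos sin unfolding s_def q_def by auto
    have "herm q p = - 2 * (herm p c * herm c p)"
      by (simp add: q_def pert_apply herm_simps p)
    then have qp: "cmod (herm q p) = 2 * (cmod (herm p c))\<^sup>2"
      unfolding herm_mult_swap by (simp add: norm_mult norm_power)
    have "t > 0"
      using s unfolding s_def by (simp add: zero_less_mult_iff)
    have "cmod (\<i> * of_real t) * cmod (herm (A *v p) p) = s * \<bar>sin (k * \<theta>)\<bar> / sin \<theta>"
      using \<open>t > 0\<close> sin
      by (simp add: Ap herm_simps p norm_mult norm_power norm_divide qp s_def)
    moreover have "0 < s * \<bar>sin (k * \<theta>)\<bar> / sin \<theta>" "s * \<bar>sin (k * \<theta>)\<bar> / sin \<theta> < 1"
      using k sin s(1) by (auto simp: cos)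
    ultimately show False
      using Shimizu[OF p T A] disc by simp
  qed
  then obtain q :: nat where q: "q \<ge> 1" "\<theta> = pi / real q"
    by blast
  \<comment> \<open>\<open>s > 0\<close> means \<open>\<theta> < pi / 2\<close>, which excludes 1
    and 2.\<close>
  have "2 < real q"
  proof (rule ccontr)
    assume "\<not> 2 < real q"
    then have "pi / 2 \<le> pi / real q"
      using q(1) by (intro divide_left_mono) simp_all
    with \<theta>(2) q(2) show False
      by simp
  qed
  with q cos show ?thesis
    by (intro exI[of _ q]) auto
qed

section \<open>Planar rotations\<close>

definition rot :: "nat \<Rightarrow> complex" where
  "rot n = exp (2 * of_real pi * \<i> / of_nat n)"

lemma rot_eq: "rot n = exp (\<i> * of_real (2 * (pi / n)))"
  by (simp add: rot_def mult_ac)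

lemma cmod_rot [simp]: "cmod (rot n) = 1"
  unfolding rot_eq by (rule norm_exp_i_times)

lemma exp_minus_one: "exp (\<i> * of_real (2 * x)) - 1 = 2 * \<i> * of_real (sin x) * exp (\<i> * of_real x)"
proof -
  have "exp (\<i> * of_real (2 * x)) = exp (\<i> * of_real x) * exp (\<i> * of_real x)"
    by (simp flip: exp_add) (simp add: algebra_simps)
  moreover have "exp (\<i> * of_real x) * exp (- (\<i> * of_real x)) = 1"
    by (simp flip: exp_add)
  moreover have "2 * \<i> * of_real (sin x) = exp (\<i> * of_real x) - exp (- (\<i> * of_real x))"
    by (simp add: sin_of_real[symmetric] sin_exp_eq)
  ultimately show ?thesis
    by algebra
qed

lemma rot_minus_one: "rot n - 1 = 2 * \<i> * of_real (sin (pi / n)) * exp (\<i> * of_real (pi / n))"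
  unfolding rot_eq by (rule exp_minus_one)

lemma cmod_rot_minus_one: "n \<ge> 1 \<Longrightarrow> cmod (rot n - 1) = 2 * sin (pi / n)"
  by (simp add: rot_minus_one norm_mult sin_ge_zero field_simps)

text \<open>The half-angle phases cancel, so the quotient is purely imaginary. It is the
  contribution of one reflection product to the vertical translation in
  \<open>vertical_translation\<close>.\<close>

lemma rot_ratio:
  "(rot m - 1) * (rot n - 1) / (rot m * rot n - 1) =
    \<i> * of_real (2 * sin (pi / m) * sin (pi / n) / sin (pi / m + pi / n))"
proof -
  have "rot m * rot n = exp (\<i> * of_real (2 * (pi / m + pi / n)))"
    unfolding rot_eq by (simp flip: exp_add) (simp add: algebra_simps)
  then have "rot m * rot n - 1 = 2 * \<i> * of_real (sin (pi / m + pi / n)) * exp (\<i> * of_real (pi / m + pi / n))"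
    by (simp only: exp_minus_one)
  also have "exp (\<i> * of_real (pi / m + pi / n)) = exp (\<i> * of_real (pi / m)) * exp (\<i> * of_real (pi / n))"
    by (simp flip: exp_add) (simp add: algebra_simps)
  finally have mn: "rot m * rot n - 1 = 2 * \<i> * of_real (sin (pi / m + pi / n)) *
    (exp (\<i> * of_real (pi / m)) * exp (\<i> * of_real (pi / n)))" .
  have cancel: "(2 * \<i> * a * e) * (2 * \<i> * b * f) / (2 * \<i> * c * (e * f)) = \<i> * (2 * a * b / c)"
    if "e \<noteq> 0" "f \<noteq> 0" for a b c e f :: complex
    using that mult_divide_mult_cancel_left[of "2 * \<i> * e * f" "2 * \<i> * a * b" c]
    by (simp add: mult_ac)
  show ?thesis
    unfolding mn rot_minus_one by (subst cancel) simp_all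
qed

lemma rot_cis: "rot n = cis (2 * (pi / n))"
  by (simp only: rot_eq cis_conv_exp)

lemma rot_3: "rot 3 = Complex (-1/2) (sqrt 3 / 2)"
  by (simp add: rot_cis complex_eq_iff cos_120 sin_120)

lemma rot_4: "rot 4 = \<i>"
  by (simp add: rot_cis complex_eq_iff)

lemma rot_2: "rot 2 = -1"
  by (simp add: rot_cis complex_eq_iff)

lemma rot_6: "rot 6 = Complex (1/2) (sqrt 3 / 2)"
  by (simp add: rot_cis complex_eq_iff cos_60 sin_60)

text \<open>If all points had modulus at least \<open>r\<close>, rotating and then flipping would decrease the squared
  modulus by a fixed amount forever.\<close>

lemma descent:
  fixes S :: "complex set"
  assumes ne: "S \<noteq> {}" and flip: "\<And>x. x \<in> S \<Longrightarrow> 1 - x \<in> S"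
    and rot: "\<And>x. x \<in> S \<Longrightarrow> \<exists>y\<in>S. cmod y = cmod x \<and> \<kappa> * cmod x \<le> Re y"
    and K: "0 < r" "1 < 2 * \<kappa> * r"
  shows "\<exists>x\<in>S. cmod x < r"
proof (rule ccontr)
  assume "\<not> ?thesis"
  then have large: "r \<le> cmod x" if "x \<in> S" for x
    using that by force
  have \<kappa>: "0 < \<kappa>"
    using K mult_nonpos_nonneg[of \<kappa> r] by linarith
  define \<epsilon> where "\<epsilon> = 2 * \<kappa> * r - 1"
  have step: "\<exists>y\<in>S. (cmod y)\<^sup>2 \<le> (cmod x)\<^sup>2 - \<epsilon>" if x: "x \<in> S" for x
  proof -
    obtain y where y: "y \<in> S" "cmod y = cmod x" "\<kappa> * cmod x \<le> Re y"
      using rot[OF x] by blast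
    have "(cmod (1 - y))\<^sup>2 = (cmod y)\<^sup>2 - 2 * Re y + 1"
      by (simp add: cmod_power2 power2_diff)
    moreover have "\<kappa> * r \<le> \<kappa> * cmod x"
      using \<kappa> large[OF x] by simp
    ultimately have "(cmod (1 - y))\<^sup>2 \<le> (cmod x)\<^sup>2 - \<epsilon>"
      using y by (simp add: \<epsilon>_def)
    with flip[OF y(1)] show ?thesis
      by blast
  qed
  obtain x0 where x0: "x0 \<in> S"
    using ne by blast
  have "\<exists>y\<in>S. (cmod y)\<^sup>2 \<le> (cmod x0)\<^sup>2 - real n * \<epsilon>" for n
  proof (induction n)
    case 0
    show ?case
      using x0 by auto
  next
    case (Suc n)
    then obtain y where "y \<in> S" "(cmod y)\<^sup>2 \<le> (cmod x0)\<^sup>2 - real n * \<epsilon>"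
      by blast
    moreover from this obtain z where "z \<in> S" "(cmod z)\<^sup>2 \<le> (cmod y)\<^sup>2 - \<epsilon>"
      using step by blast
    ultimately have "z \<in> S" "(cmod z)\<^sup>2 \<le> (cmod x0)\<^sup>2 - real (Suc n) * \<epsilon>"
      by (simp_all add: algebra_simps)
    then show ?case
      by blast
  qed
  moreover obtain n :: nat where "(cmod x0)\<^sup>2 < real n * \<epsilon>"
    using reals_Archimedean3[of \<epsilon>] K by (auto simp: \<epsilon>_def)
  ultimately show False
    by (smt (verit) zero_le_power2)
qed

text \<open>One of the three rotates lies within 60 degrees of the positive real axis, hence the
  constant 1/2.\<close>

lemma rotate_3:
  assumes rot: "\<And>x. x \<in> S \<Longrightarrow> rot 3 * x \<in> S" and x: "x \<in> S"
  shows "\<exists>y\<in>S. cmod y = cmod x \<and> 1 / 2 * cmod x \<le> Re y"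
proof (rule ccontr)
  assume neg: "\<not> ?thesis"
  define a where "a = Re x"
  define b where "b = Im x"
  define r where "r = cmod x"
  have r: "r\<^sup>2 = a\<^sup>2 + b\<^sup>2" "0 \<le> r"
    by (simp_all add: r_def a_def b_def cmod_power2)
  define y where "y = rot 3 * x"
  define z where "z = rot 3 * y"
  have S: "x \<in> S" "y \<in> S" "z \<in> S"
    using rot x by (auto simp: y_def z_def)
  have n: "cmod x = r" "cmod y = r" "cmod z = r"
    by (simp_all add: y_def z_def r_def norm_mult)
  have bound: "2 * Re w < r" if "w \<in> S" "cmod w = r" for w
    using neg that unfolding r_def by (auto simp: not_le)
  have Re: "Re x = a" "Re y = (- a - sqrt 3 * b) / 2" "Re z = (- a + sqrt 3 * b) / 2"
    by (simp_all add: z_def y_def rot_3 a_def b_def field_simps)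
  have 1: "2 * a < r" and 2: "- a - sqrt 3 * b < r" and 3: "- a + sqrt 3 * b < r"
    using bound[OF S(1) n(1)] bound[OF S(2) n(2)] bound[OF S(3) n(3)] unfolding Re by simp_all
  define c where "c = sqrt 3 * b"
  have c: "c\<^sup>2 = 3 * b\<^sup>2"
    by (simp add: c_def power_mult_distrib)
  have "\<bar>c\<bar> < r + a"
    using 2 3 unfolding c_def by linarith
  then have "\<bar>c\<bar>\<^sup>2 < (r + a)\<^sup>2"
    by (intro power_strict_mono) auto
  then have "3 * (r\<^sup>2 - a\<^sup>2) < (r + a)\<^sup>2"
    using c r by simp
  then have "(r + a) * (2 * r - 4 * a) < 0"
    by (simp add: power2_eq_square algebra_simps)
  moreover have "0 < r + a" "0 < 2 * r - 4 * a"
    using 1 \<open>\<bar>c\<bar> < r + a\<close> by linarith+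
  ultimately show False
    by (simp add: mult_less_0_iff)
qed

lemma max_component_ge:
  assumes "r\<^sup>2 \<le> a\<^sup>2 + b\<^sup>2" "0 \<le> (r::real)"
  shows "sqrt 2 / 2 * r \<le> \<bar>a\<bar> \<or> sqrt 2 / 2 * r \<le> \<bar>b\<bar>"
proof (rule ccontr)
  assume "\<not> ?thesis"
  then have "\<bar>a\<bar>\<^sup>2 < (sqrt 2 / 2 * r)\<^sup>2" "\<bar>b\<bar>\<^sup>2 < (sqrt 2 / 2 * r)\<^sup>2"
    using power_strict_mono[of "\<bar>a\<bar>" "sqrt 2 / 2 * r" 2] power_strict_mono[of "\<bar>b\<bar>" "sqrt 2 / 2 * r" 2] by simp_all
  then show False
    using assms by (simp add: power_mult_distrib power_divide)
qed

lemma rotate_4: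
  assumes rot: "\<And>x. x \<in> S \<Longrightarrow> rot 4 * x \<in> S" and x: "x \<in> S"
  shows "\<exists>y\<in>S. cmod y = cmod x \<and> sqrt 2 / 2 * cmod x \<le> Re y"
proof -
  have S: "\<i> * x \<in> S" "\<i> * (\<i> * x) \<in> S" "\<i> * (\<i> * (\<i> * x)) \<in> S"
    using rot[OF x] rot[OF rot[OF x]] rot[OF rot[OF rot[OF x]]] by (simp_all only: rot_4)
  have "sqrt 2 / 2 * cmod x \<le> \<bar>Re x\<bar> \<or> sqrt 2 / 2 * cmod x \<le> \<bar>Im x\<bar>"
    by (intro max_component_ge) (simp_all add: cmod_power2)
  then consider "sqrt 2 / 2 * cmod x \<le> Re x" | "sqrt 2 / 2 * cmod x \<le> - Re x"
    | "sqrt 2 / 2 * cmod x \<le> Im x" | "sqrt 2 / 2 * cmod x \<le> - Im x"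
    by (auto simp: abs_if split: if_splits)
  then show ?thesis
  proof cases
    case 1
    then show ?thesis using x by blast
  next
    case 2
    then show ?thesis by (intro bexI[OF _ S(2)]) (simp add: norm_mult)
  next
    case 3
    then show ?thesis by (intro bexI[OF _ S(3)]) (simp add: norm_mult)
  next
    case 4
    then show ?thesis by (intro bexI[OF _ S(1)]) (simp add: norm_mult)
  qed
qed

text \<open>The six rotates form three opposite pairs, and the squared real parts of one member of
  each add up to 3/2 of the squared modulus, so one of them is at least the average. The sharp
  constant is cos(\<pi>/6); this one is enough for the descent below.\<close>

lemma rotate_6:
  assumes rot: "\<And>x. x \<in> S \<Longrightarrow> rot 6 * x \<in> S" and x: "x \<in> S"
  shows "\<exists>y\<in>S. cmod y = cmod x \<and> sqrt 2 / 2 * cmod x \<le> Re y"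
proof (rule ccontr)
  assume neg: "\<not> ?thesis"
  define a where "a = Re x"
  define b where "b = Im x"
  define r where "r = cmod x"
  define c where "c = sqrt 3 * b"
  have c: "c\<^sup>2 = 3 * b\<^sup>2"
    by (simp add: c_def power_mult_distrib)
  have r: "r\<^sup>2 = a\<^sup>2 + b\<^sup>2" "0 \<le> r"
    by (simp_all add: r_def a_def b_def cmod_power2)
  have S1: "rot 6 * y \<in> S \<and> cmod (rot 6 * y) = cmod y" if "y \<in> S" for y
    using rot that by (simp add: norm_mult)
  have x3: "rot 6 * (rot 6 * (rot 6 * x)) = - x"
    by (simp add: rot_6 complex_eq_iff algebra_simps)
  have bound: "\<bar>Re y\<bar> < sqrt 2 / 2 * r" if y: "y \<in> S" "cmod y = r" "- y \<in> S" for y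
  proof -
    have "\<not> sqrt 2 / 2 * cmod x \<le> Re y" "\<not> sqrt 2 / 2 * cmod x \<le> Re (- y)"
      using neg y unfolding r_def by (metis norm_minus_cancel)+
    then show ?thesis
      by (simp add: r_def abs_less_iff)
  qed
  define y where "y = rot 6 * x"
  define z where "z = rot 6 * y"
  have S: "x \<in> S" "y \<in> S" "z \<in> S" "- x \<in> S"
    using S1 x x3 unfolding y_def z_def by metis+
  then have S': "- y \<in> S" "- z \<in> S"
    using rot[of "- x"] rot[of "- y"] rot[OF rot[of "- x"]] by (auto simp: y_def z_def)
  have n: "cmod y = r" "cmod z = r"
    by (simp_all add: y_def z_def r_def norm_mult)
  have Re: "Re x = a" "Re y = (a - c) / 2" "Re z = (- a - c) / 2"
    by (simp_all add: z_def y_def rot_6 a_def b_def c_def algebra_simps)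
  have sq: "(Re w)\<^sup>2 < (sqrt 2 / 2 * r)\<^sup>2" if "\<bar>Re w\<bar> < sqrt 2 / 2 * r" for w
    using power_strict_mono[OF that, of 2] by simp
  have sum: "(Re x)\<^sup>2 + (Re y)\<^sup>2 + (Re z)\<^sup>2 < 3 * (sqrt 2 / 2 * r)\<^sup>2"
    using sq[OF bound[OF S(1) r_def[symmetric] S(4)]] sq[OF bound[OF S(2) n(1) S'(1)]]
      sq[OF bound[OF S(3) n(2) S'(2)]] by linarith
  have "(Re x)\<^sup>2 + (Re y)\<^sup>2 + (Re z)\<^sup>2 = 3 / 2 * a\<^sup>2 + c\<^sup>2 / 2"
    unfolding Re by (simp add: power2_eq_square field_simps)
  also have "\<dots> = 3 * (sqrt 2 / 2 * r)\<^sup>2"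
    unfolding c by (simp add: power_mult_distrib power_divide r(1))
  finally show False
    using sum by simp
qed

section \<open>The stabiliser of the common boundary point\<close>

context PU21_subgroup
begin

text \<open>Solves the linear recurrence for the powers of the product of the two reflections;
  \<open>g k\<close> is the geometric sum of \<open>a * b\<close>. Once
  \<open>(a * b) ^ k = 1\<close>, only a term along \<open>p\<close> remains, and it is linear in
  \<open>k\<close>.\<close>

lemma reflection_product_power:
  assumes c: "herm c\<^sub>1 c\<^sub>1 = 1" "herm c\<^sub>2 c\<^sub>2 = 1" "herm c\<^sub>1 c\<^sub>2 = 1"
    and R: "pert (a - 1) c\<^sub>1 \<in> lift \<Gamma>" "pert (b - 1) c\<^sub>2 \<in> lift \<Gamma>"
    and \<lambda>: "a * b \<noteq> 1"
  defines "p \<equiv> c\<^sub>1 - c\<^sub>2"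
  defines "g \<equiv> \<lambda>k::nat. ((a * b) ^ k - 1) / (a * b - 1)"
  shows "\<exists>A\<in>lift \<Gamma>. \<forall>z. A *v z = z
    + (((a * b) ^ k - 1) * herm z c\<^sub>1 - a * (b - 1) * g k * herm z p) *s c\<^sub>1
    + ((of_nat k * (b - 1) + a * (b - 1)\<^sup>2 / (a * b - 1) * (g k - of_nat k)) * herm z p
        - (b - 1) * g k * herm z c\<^sub>1) *s p"
proof (induction k)
  case 0
  show ?case
    by (rule bexI[OF _ lift_one]) (simp add: g_def)
next
  case (Suc k)
  then obtain A where A: "A \<in> lift \<Gamma>" and Az: "\<And>z. A *v z = z
    + (((a * b) ^ k - 1) * herm z c\<^sub>1 - a * (b - 1) * g k * herm z p) *s c\<^sub>1
    + ((of_nat k * (b - 1) + a * (b - 1)\<^sup>2 / (a * b - 1) * (g k - of_nat k)) * herm z p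
        - (b - 1) * g k * herm z c\<^sub>1) *s p"
    by blast
  define M where "M = pert (a - 1) c\<^sub>1 ** pert (b - 1) c\<^sub>2"
  have c21: "herm c\<^sub>2 c\<^sub>1 = 1"
    using cnj_herm[of c\<^sub>1 c\<^sub>2] c by simp
  have p: "herm p p = 0" "herm c\<^sub>1 p = 0" "herm p c\<^sub>1 = 0"
    by (simp_all add: p_def herm_simps c c21)
  have M: "M *v y = y + ((a * b - 1) * herm y c\<^sub>1 - a * (b - 1) * herm y p) *s c\<^sub>1
      + ((b - 1) * herm y p - (b - 1) * herm y c\<^sub>1) *s p" for y
    unfolding M_def p_def
    by (simp add: pert_apply herm_simps c c21 vec_eq_iff algebra_simps flip: matrix_vector_mul_assoc)
  have gS: "g (Suc k) = 1 + a * b * g k"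
    using \<lambda> by (simp add: g_def field_simps)
  have gk: "(a * b) ^ k = 1 + (a * b - 1) * g k"
    using \<lambda> by (simp add: g_def)
  define h where "h = a * (b - 1)\<^sup>2 / (a * b - 1)"
  have h: "h * (a * b - 1) = a * (b - 1)\<^sup>2"
    using \<lambda> by (simp add: h_def)
  have "(M ** A) *v z = z
    + (((a * b) ^ Suc k - 1) * herm z c\<^sub>1 - a * (b - 1) * g (Suc k) * herm z p) *s c\<^sub>1
    + ((of_nat (Suc k) * (b - 1) + h * (g (Suc k) - of_nat (Suc k))) * herm z p
        - (b - 1) * g (Suc k) * herm z c\<^sub>1) *s p" for z
  proof -
    define u where "u = ((a * b) ^ k - 1) * herm z c\<^sub>1 - a * (b - 1) * g k * herm z p"
    define w where "w = (of_nat k * (b - 1) + h * (g k - of_nat k)) * herm z p - (b - 1) * g k * herm z c\<^sub>1"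
    have Az': "A *v z = z + u *s c\<^sub>1 + w *s p"
      unfolding Az u_def w_def h_def ..
    have "herm (A *v z) c\<^sub>1 = herm z c\<^sub>1 + u" "herm (A *v z) p = herm z p"
      by (simp_all add: Az' herm_simps c p)
    then have "(M ** A) *v z = z
        + (u + (a * b - 1) * (herm z c\<^sub>1 + u) - a * (b - 1) * herm z p) *s c\<^sub>1
        + (w + (b - 1) * herm z p - (b - 1) * (herm z c\<^sub>1 + u)) *s p"
      by (simp add: M flip: matrix_vector_mul_assoc) (simp add: Az' vec_eq_iff algebra_simps)
    moreover have "u + (a * b - 1) * (herm z c\<^sub>1 + u) - a * (b - 1) * herm z p =
        ((a * b) ^ Suc k - 1) * herm z c\<^sub>1 - a * (b - 1) * g (Suc k) * herm z p"
      by (simp add: u_def gS algebra_simps)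
    moreover have "w + (b - 1) * herm z p - (b - 1) * (herm z c\<^sub>1 + u) =
        (of_nat (Suc k) * (b - 1) + h * (g (Suc k) - of_nat (Suc k))) * herm z p
        - (b - 1) * g (Suc k) * herm z c\<^sub>1"
    proof -
      have "h * (g (Suc k) - of_nat (Suc k)) = h * (g k - of_nat k) + a * (b - 1)\<^sup>2 * g k"
        unfolding gS h[symmetric] by (simp add: algebra_simps)
      then show ?thesis
        by (simp only: w_def u_def gk gS) (simp add: algebra_simps power2_eq_square)
    qed
    ultimately show ?thesis
      by simp
  qed
  moreover have "M ** A \<in> lift \<Gamma>"
    unfolding M_def by (intro lift_mult R A)
  ultimately show ?case
    unfolding h_def by blast
qed

text \<open>The reflection product has rotation angle 2\<pi>(1/m + 1/n). After \<open>N\<close>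
  factors the rotation is a whole number of turns, and what is left is \<open>N\<close> times the
  vertical part given by \<open>rot_ratio\<close>.\<close>

lemma vertical_translation:
  assumes c: "herm c\<^sub>1 c\<^sub>1 = 1" "herm c\<^sub>2 c\<^sub>2 = 1" "herm c\<^sub>1 c\<^sub>2 = 1"
    and R: "pert (rot m - 1) c\<^sub>1 \<in> lift \<Gamma>" "pert (rot n - 1) c\<^sub>2 \<in> lift \<Gamma>"
    and sin: "sin (pi / m + pi / n) \<noteq> 0" and N: "real N * (1 / m + 1 / n) \<in> \<int>"
  shows "pert (\<i> * of_real (2 * real N * sin (pi / m) * sin (pi / n) / sin (pi / m + pi / n))) (c\<^sub>1 - c\<^sub>2) \<in> lift \<Gamma>"
proof -
  define a where "a = rot m"
  define b where "b = rot n"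
  define t where "t = 2 * sin (pi / m) * sin (pi / n) / sin (pi / m + pi / n)"
  have ab: "a * b = cis (2 * (pi / m + pi / n))"
    by (simp add: a_def b_def rot_cis cis_mult algebra_simps)
  then have "a * b - 1 = 2 * \<i> * of_real (sin (pi / m + pi / n)) * exp (\<i> * of_real (pi / m + pi / n))"
    by (simp only: cis_conv_exp exp_minus_one)
  then have "a * b - 1 \<noteq> 0"
    using sin by simp
  then have ne: "a * b \<noteq> 1"
    by simp
  have "(a * b) ^ N = cis (real N * (2 * (pi / m + pi / n)))"
    by (simp only: ab Complex.DeMoivre)
  also have "real N * (2 * (pi / m + pi / n)) = 2 * pi * (real N * (1 / m + 1 / n))"
    by (simp add: algebra_simps)
  finally have abN: "(a * b) ^ N = 1"
    using N by (simp only: cis_multiple_2pi)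
  obtain A where A: "A \<in> lift \<Gamma>" and "\<And>z. A *v z = z
    + (((a * b) ^ N - 1) * herm z c\<^sub>1 - a * (b - 1) * (((a * b) ^ N - 1) / (a * b - 1)) * herm z (c\<^sub>1 - c\<^sub>2)) *s c\<^sub>1
    + ((of_nat N * (b - 1) + a * (b - 1)\<^sup>2 / (a * b - 1) * (((a * b) ^ N - 1) / (a * b - 1) - of_nat N)) * herm z (c\<^sub>1 - c\<^sub>2)
        - (b - 1) * (((a * b) ^ N - 1) / (a * b - 1)) * herm z c\<^sub>1) *s (c\<^sub>1 - c\<^sub>2)"
    using reflection_product_power[OF c, of a b N] R ne unfolding a_def b_def by blast
  then have Az: "A *v z = z + ((of_nat N * (b - 1) - a * (b - 1)\<^sup>2 / (a * b - 1) * of_nat N) * herm z (c\<^sub>1 - c\<^sub>2)) *s (c\<^sub>1 - c\<^sub>2)" for z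
    unfolding abN by simp
  have "of_nat N * (b - 1) - a * (b - 1)\<^sup>2 / (a * b - 1) * of_nat N = of_nat N * ((a - 1) * (b - 1) / (a * b - 1))"
    using ne by (simp add: field_simps power2_eq_square)
  also have "\<dots> = \<i> * of_real (real N * t)"
    unfolding a_def b_def rot_ratio t_def by simp
  finally have "A = pert (\<i> * of_real (real N * t)) (c\<^sub>1 - c\<^sub>2)"
    by (simp add: matrix_eq pert_apply Az)
  with A show ?thesis
    by (simp add: t_def mult_ac)
qed

text \<open>Dividing by \<open>herm p e\<close> makes the stabiliser of \<open>p\<close> act by Euclidean motions of the plane; the two
  reflections act as rotations about 0 and 1.\<close>

definition orbit :: "complex ^ 3 \<Rightarrow> complex ^ 3 \<Rightarrow> complex ^ 3 \<Rightarrow> complex set" where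
  "orbit c p e = {herm (A *v c) e / herm p e | A. A \<in> lift \<Gamma> \<and> A *v p = p}"

text \<open>The reflection is multiplied to \<open>A\<close> from the right: the first scales
  \<open>c\<^sub>1\<close> by \<open>a\<close>, the second scales
  \<open>c\<^sub>2 = c\<^sub>1 - p\<close> by \<open>b\<close>, and \<open>A\<close> fixes
  \<open>p\<close>.\<close>

lemma orbit_rotate:
  assumes c: "herm c\<^sub>1 c\<^sub>1 = 1" "herm c\<^sub>2 c\<^sub>2 = 1" "herm c\<^sub>1 c\<^sub>2 = 1"
    and R: "pert (a - 1) c\<^sub>1 \<in> lift \<Gamma>" "pert (b - 1) c\<^sub>2 \<in> lift \<Gamma>"
  defines "p \<equiv> c\<^sub>1 - c\<^sub>2"
  assumes pe: "herm p e \<noteq> 0" and z: "z \<in> orbit c\<^sub>1 p e"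
  shows "a * z \<in> orbit c\<^sub>1 p e" "1 + b * (z - 1) \<in> orbit c\<^sub>1 p e"
proof -
  have c21: "herm c\<^sub>2 c\<^sub>1 = 1"
    using cnj_herm[of c\<^sub>1 c\<^sub>2] c by simp
  obtain A where A: "A \<in> lift \<Gamma>" "A *v p = p" "z = herm (A *v c\<^sub>1) e / herm p e"
    using z by (auto simp: orbit_def)
  have Rp: "pert (a - 1) c\<^sub>1 *v p = p" "pert (b - 1) c\<^sub>2 *v p = p"
    by (simp_all add: p_def pert_apply herm_simps c c21)
  have "pert (a - 1) c\<^sub>1 *v c\<^sub>1 = a *s c\<^sub>1"
    by (simp add: pert_apply c vec_eq_iff algebra_simps)
  then have "herm ((A ** pert (a - 1) c\<^sub>1) *v c\<^sub>1) e / herm p e = a * z"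
    by (simp add: A(3) vector_scalar_commute herm_simps flip: matrix_vector_mul_assoc)
  then show "a * z \<in> orbit c\<^sub>1 p e"
    using lift_mult[OF A(1) R(1)] A(2) Rp unfolding orbit_def
    by (auto intro!: exI[of _ "A ** pert (a - 1) c\<^sub>1"] simp flip: matrix_vector_mul_assoc)
  have "pert (b - 1) c\<^sub>2 *v c\<^sub>1 = c\<^sub>1 + (b - 1) *s (c\<^sub>1 - p)"
    by (simp add: pert_apply c p_def)
  then have eq: "(A ** pert (b - 1) c\<^sub>2) *v c\<^sub>1 = A *v c\<^sub>1 + (b - 1) *s (A *v c\<^sub>1 - p)"
    by (simp only: matrix_vector_mul_assoc[symmetric] vector_scalar_commute matrix_vector_right_distrib
        matrix_vector_mult_diff_distrib A(2))
  have "herm ((A ** pert (b - 1) c\<^sub>2) *v c\<^sub>1) e / herm p e = 1 + b * (z - 1)"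
    using pe unfolding eq by (simp add: A(3) herm_simps field_simps)
  then show "1 + b * (z - 1) \<in> orbit c\<^sub>1 p e"
    using lift_mult[OF A(1) R(2)] A(2) Rp unfolding orbit_def
    by (auto intro!: exI[of _ "A ** pert (b - 1) c\<^sub>2"] simp flip: matrix_vector_mul_assoc)
qed

text \<open>\<open>A\<close> conjugates the two reflections to ones with vectors
  \<open>A *v c\<^sub>1\<close> and \<open>A *v c\<^sub>2\<close>. These are orthogonal to
  \<open>p\<close>, and their products with \<open>e\<close> are \<open>z\<close> and
  \<open>z - 1\<close> times \<open>herm p e\<close>, so \<open>Shimizu_reflected\<close>
  applies.\<close>

lemma orbit_lower_bound:
  assumes disc: "discrete_in_PU21 \<Gamma>"
    and c: "herm c\<^sub>1 c\<^sub>1 = 1" "herm c\<^sub>2 c\<^sub>2 = 1" "herm c\<^sub>1 c\<^sub>2 = 1"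
    and R: "pert a c\<^sub>1 \<in> lift \<Gamma>" "pert b c\<^sub>2 \<in> lift \<Gamma>" "pert (-2) e \<in> lift \<Gamma>"
    and ab: "a \<noteq> 0" "b \<noteq> 0"
  defines "p \<equiv> c\<^sub>1 - c\<^sub>2"
  assumes T: "pert d p \<in> lift \<Gamma>" "d \<noteq> 0"
    and pe: "herm p e \<noteq> 0" and z: "z \<in> orbit c\<^sub>1 p e"
  shows "z \<noteq> 0 \<Longrightarrow> 1 \<le> 4 * cmod d * cmod a * ((cmod (herm p e))\<^sup>2)\<^sup>2 * (cmod z)\<^sup>2"
    and "z \<noteq> 1 \<Longrightarrow> 1 \<le> 4 * cmod d * cmod b * ((cmod (herm p e))\<^sup>2)\<^sup>2 * (cmod (z - 1))\<^sup>2"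
proof -
  have c21: "herm c\<^sub>2 c\<^sub>1 = 1"
    using cnj_herm[of c\<^sub>1 c\<^sub>2] c by simp
  have p: "herm p p = 0" "herm p c\<^sub>1 = 0" "herm p c\<^sub>2 = 0"
    by (simp_all add: p_def herm_simps c c21)
  obtain A where A: "A \<in> lift \<Gamma>" "A *v p = p" "z = herm (A *v c\<^sub>1) e / herm p e"
    using z by (auto simp: orbit_def)
  have ze: "herm (A *v c\<^sub>1) e = z * herm p e"
    using A(3) pe by simp
  have "A *v c\<^sub>2 = A *v (c\<^sub>1 - p)"
    by (simp add: p_def)
  then have eq: "A *v c\<^sub>2 = A *v c\<^sub>1 - p"
    by (simp only: matrix_vector_mult_diff_distrib A(2))
  have ze1: "herm (A *v c\<^sub>2) e = (z - 1) * herm p e"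
    unfolding eq by (simp add: herm_simps ze algebra_simps)
  have orth: "herm p (A *v c\<^sub>1) = 0" "herm p (A *v c\<^sub>2) = 0"
    using U21_herm[OF lift_carrier[OF A(1)], of p] A(2) p by metis+
  note S = Shimizu_reflected[OF p(1) T(1) R(3) lift_pert_conj[OF A(1) R(1)] orth(1)]
    Shimizu_reflected[OF p(1) T(1) R(3) lift_pert_conj[OF A(1) R(2)] orth(2)]
  show "1 \<le> 4 * cmod d * cmod a * ((cmod (herm p e))\<^sup>2)\<^sup>2 * (cmod z)\<^sup>2" if "z \<noteq> 0"
  proof (rule ccontr)
    assume neg: "\<not> ?thesis"
    have eq: "4 * cmod d * cmod a * ((cmod (herm p e))\<^sup>2)\<^sup>2 * (cmod z)\<^sup>2 =
        4 * cmod d * cmod a * (cmod (herm p e))\<^sup>2 * (cmod (herm (A *v c\<^sub>1) e))\<^sup>2"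
      by (simp add: ze norm_mult power_mult_distrib power2_eq_square mult_ac)
    have "0 < 4 * cmod d * cmod a * ((cmod (herm p e))\<^sup>2)\<^sup>2 * (cmod z)\<^sup>2"
      using that ab T pe by simp
    then show False
      using S(1) disc neg unfolding eq by simp
  qed
  show "1 \<le> 4 * cmod d * cmod b * ((cmod (herm p e))\<^sup>2)\<^sup>2 * (cmod (z - 1))\<^sup>2" if "z \<noteq> 1"
  proof (rule ccontr)
    assume neg: "\<not> ?thesis"
    have eq: "4 * cmod d * cmod b * ((cmod (herm p e))\<^sup>2)\<^sup>2 * (cmod (z - 1))\<^sup>2 =
        4 * cmod d * cmod b * (cmod (herm p e))\<^sup>2 * (cmod (herm (A *v c\<^sub>2) e))\<^sup>2"
      by (simp add: ze1 norm_mult power_mult_distrib power2_eq_square mult_ac)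
    have "0 < 4 * cmod d * cmod b * ((cmod (herm p e))\<^sup>2)\<^sup>2 * (cmod (z - 1))\<^sup>2"
      using that ab T pe by simp
    then show False
      using S(2) disc neg unfolding eq by simp
  qed
qed

end

text \<open>For equal angles, the half-turn about 1/2 exchanges the rotation centres 0 and 1; adding
  the images of \<open>S\<close> under it gives a set to which \<open>descent\<close>
  applies.\<close>

lemma descent_symmetric:
  fixes S :: "complex set"
  assumes ne: "S \<noteq> {}"
    and rot: "\<And>z. z \<in> S \<Longrightarrow> u * z \<in> S" "\<And>z. z \<in> S \<Longrightarrow> 1 + u * (z - 1) \<in> S"
    and rotate: "\<And>S' x. (\<And>x. x \<in> S' \<Longrightarrow> u * x \<in> S') \<Longrightarrow> x \<in> S' \<Longrightarrow> \<exists>y\<in>S'. cmod y = cmod x \<and> \<kappa> * cmod x \<le> Re y"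
    and K: "0 < r" "1 < 2 * \<kappa> * r" and f: "0 < f" "f < 1" "f * r\<^sup>2 \<le> 1"
  shows "\<exists>z\<in>S. z \<noteq> 0 \<and> f * (cmod z)\<^sup>2 < 1 \<or> z \<noteq> 1 \<and> f * (cmod (z - 1))\<^sup>2 < 1"
proof -
  define S' where "S' = {x. x \<in> S \<or> 1 - x \<in> S}"
  have flip: "1 - x \<in> S'" if "x \<in> S'" for x
    using that by (auto simp: S'_def)
  have rot': "u * x \<in> S'" if "x \<in> S'" for x
    using that rot(1)[of x] rot(2)[of "1 - x"] by (auto simp: S'_def)
  have S': "f * (cmod x)\<^sup>2 < 1 \<Longrightarrow> x \<noteq> 0 \<Longrightarrow> ?thesis" if "x \<in> S'" for x
  proof (cases "x \<in> S")
    case False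
    then have "1 - x \<in> S"
      using that by (simp add: S'_def)
    then show "f * (cmod x)\<^sup>2 < 1 \<Longrightarrow> x \<noteq> 0 \<Longrightarrow> ?thesis"
      by (intro bexI[of _ "1 - x"]) auto
  qed auto
  obtain x where x: "x \<in> S'" "cmod x < r"
    using descent[of S' \<kappa> r] ne flip rotate[OF rot'] K by (auto simp: S'_def)
  show ?thesis
  proof (cases "x = 0")
    \<comment> \<open>The descent may end exactly on a centre. The flipped point 1 is then used
      instead, which needs \<open>f < 1\<close>.\<close>
    case True
    then show ?thesis
      using S'[OF flip[OF x(1)]] f by simp
  next
    case False
    have "(cmod x)\<^sup>2 < r\<^sup>2"
      using x by (intro power_strict_mono) auto
    then have "f * (cmod x)\<^sup>2 < f * r\<^sup>2"
      using f by simp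
    with f have "f * (cmod x)\<^sup>2 < 1"
      by linarith
    with False show ?thesis
      using S'[OF x(1)] by simp
  qed
qed

text \<open>The coordinate x = (1 - z)/2 moves the centre 1 to the origin and turns the half-turn
  about 0 into the flip x -> 1 - x. Lengths are halved, hence \<open>2 * r\<close>.\<close>

lemma descent_half:
  fixes S :: "complex set"
  assumes ne: "S \<noteq> {}"
    and rot: "\<And>z. z \<in> S \<Longrightarrow> - z \<in> S" "\<And>z. z \<in> S \<Longrightarrow> 1 + u * (z - 1) \<in> S"
    and rotate: "\<And>S' x. (\<And>x. x \<in> S' \<Longrightarrow> u * x \<in> S') \<Longrightarrow> x \<in> S' \<Longrightarrow> \<exists>y\<in>S'. cmod y = cmod x \<and> \<kappa> * cmod x \<le> Re y"
    and K: "0 < r" "1 < 2 * \<kappa> * r"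
  shows "1 \<in> S \<or> (\<exists>z\<in>S. z \<noteq> 1 \<and> cmod (z - 1) < 2 * r)"
proof -
  define S' where "S' = {x. 1 - 2 * x \<in> S}"
  have flip: "1 - x \<in> S'" if "x \<in> S'" for x
    using that rot(1)[of "1 - 2 * x"] by (simp add: S'_def algebra_simps)
  have rot': "u * x \<in> S'" if "x \<in> S'" for x
    using that rot(2)[of "1 - 2 * x"] by (simp add: S'_def algebra_simps)
  obtain z where "z \<in> S"
    using ne by blast
  then have "(1 - z) / 2 \<in> S'"
    by (simp add: S'_def diff_divide_distrib)
  then obtain x where x: "x \<in> S'" "cmod x < r"
    using descent[of S' \<kappa> r] flip rotate[OF rot'] K by blast
  show ?thesis
  proof (cases "x = 0")
    case False
    then show ?thesis
      using x by (intro disjI2 bexI[of _ "1 - 2 * x"]) (auto simp: S'_def norm_mult)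
  qed (use x in \<open>simp add: S'_def\<close>)
qed

section \<open>Non-discreteness\<close>

definition triangle_types :: "(nat \<times> nat \<times> real \<times> nat) set" where
  "triangle_types = {(3, 3, 6 * sqrt 3, 6), (2, 3, 24 * sqrt 3, 6), (2, 6, 4 * sqrt 3, 4),
            (3, 6, 2 * sqrt 3, 3), (2, 4, 16, 3), (4, 4, 4, 4)}"

text \<open>\<open>N\<close> is the order of \<open>rot m * rot n\<close> in each row.\<close>

lemma vertical_translation_length:
  assumes "(m, n, \<nu>, q) \<in> triangle_types"
  shows "sin (pi / m + pi / n) \<noteq> 0 \<and> (\<exists>N::nat. real N * (1 / m + 1 / n) \<in> \<int> \<and>
    2 * real N * sin (pi / m) * sin (pi / n) / sin (pi / m + pi / n) = \<nu> / 2)"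
proof -
  have s3: "sqrt 3 * sqrt 3 = 3" and s2: "sqrt 2 * sqrt 2 = 2"
    by simp_all
  note simps = sin_60 cos_60 sin_30 cos_30 sin_45 cos_45 s3 s2 field_simps
  consider "m = 3" "n = 3" "\<nu> = 6 * sqrt 3" | "m = 2" "n = 3" "\<nu> = 24 * sqrt 3"
    | "m = 2" "n = 6" "\<nu> = 4 * sqrt 3" | "m = 3" "n = 6" "\<nu> = 2 * sqrt 3"
    | "m = 2" "n = 4" "\<nu> = 16" | "m = 4" "n = 4" "\<nu> = 4"
    using assms by (auto simp: triangle_types_def)
  then show ?thesis
  proof cases
    case 1
    show ?thesis
      unfolding sin_add 1 by (intro conjI exI[of _ 3]) (simp_all add: simps)
  next
    case 2
    show ?thesis
      unfolding sin_add 2 by (intro conjI exI[of _ 6]) (simp_all add: simps)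
  next
    case 3
    show ?thesis
      unfolding sin_add 3 by (intro conjI exI[of _ 3]) (simp_all add: simps)
  next
    case 4
    show ?thesis
      unfolding sin_add 4 by (intro conjI exI[of _ 2]) (simp_all add: simps)
  next
    case 5
    show ?thesis
      unfolding sin_add 5 by (intro conjI exI[of _ 4]) (simp_all add: simps)
  next
    case 6
    show ?thesis
      unfolding sin_add 6 by (intro conjI exI[of _ 2]) (simp_all add: simps)
  qed
qed

lemma cos_pi_divide_strict_mono:
  assumes "1 \<le> q" "q < r"
  shows "cos (pi / real q) < cos (pi / real r)"
proof (rule cos_monotone_0_pi)
  show "pi / real r < pi / real q"
    using assms by (simp add: divide_strict_left_mono)
  show "pi / real q \<le> pi"
    using assms divide_left_mono[of 1 "real q" pi] by simp
qed simp

text \<open>Supplies a point violating \<open>orbit_lower_bound\<close>, rescaled with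
  \<open>s = \<nu> * D\<close>. Rows with \<open>q\<^sub>0 = 3\<close> leave no \<open>q\<close>,
  those with \<open>q\<^sub>0 = 4\<close> only \<open>q = 3\<close> and \<open>s = 1\<close>, and
  \<open>q\<^sub>0 = 6\<close> gives \<open>s\<^sup>2 < 3\<close>.\<close>

lemma small_orbit_point:
  fixes S :: "complex set"
  assumes tab: "(m, n, \<nu>, q\<^sub>0) \<in> triangle_types" and q: "3 \<le> q" "q < q\<^sub>0" and s: "s = 2 * cos (pi / real q)"
    and ne: "S \<noteq> {}"
    and rot: "\<And>z. z \<in> S \<Longrightarrow> rot m * z \<in> S" "\<And>z. z \<in> S \<Longrightarrow> 1 + rot n * (z - 1) \<in> S"
  shows "\<exists>z\<in>S. z \<noteq> 0 \<and> 2 * s\<^sup>2 * cmod (rot m - 1) * (cmod z)\<^sup>2 < \<nu> \<or>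
    z \<noteq> 1 \<and> 2 * s\<^sup>2 * cmod (rot n - 1) * (cmod (z - 1))\<^sup>2 < \<nu>"
proof -
  have s1: "1 \<le> s"
    using cos_pi_divide_strict_mono[of 3 q] q s by (cases "q = 3") (auto simp: cos_60)
  have s_q3: "s = 1" if "q\<^sub>0 = 4"
  proof -
    have "q = 3"
      using that q by simp
    then show ?thesis
      by (simp add: s cos_60)
  qed
  have s_6: "s\<^sup>2 < 3" if "q\<^sub>0 = 6"
  proof -
    have "s < sqrt 3"
      using cos_pi_divide_strict_mono[of q 6] q s that by (simp add: cos_30)
    then have "s\<^sup>2 < (sqrt 3)\<^sup>2"
      using s1 by (intro power_strict_mono) auto
    then show ?thesis
      by simp
  qed
  \<comment> \<open>For the orders (3,3) and (2,3) the bounds ask for a distance below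
    \<open>r\<close> and \<open>2 * r\<close> respectively. Descent with constant 1/2 reaches every
    radius above 1, and \<open>r > 1\<close> amounts to \<open>q < 6\<close>.\<close>
  define r where "r = sqrt 3 / s"
  have r: "0 < r" "r\<^sup>2 * s\<^sup>2 = 3"
    using s1 by (simp_all add: r_def power_divide)
  have r1: "1 < r" if "q\<^sub>0 = 6"
  proof -
    have "s\<^sup>2 * 1\<^sup>2 < s\<^sup>2 * r\<^sup>2"
      using r s_6[OF that] by (simp add: mult.commute)
    then have "1\<^sup>2 < r\<^sup>2"
      using s1 by (subst (asm) mult_less_cancel_left_pos) auto
    then show ?thesis
      by (rule power2_less_imp_less) (simp add: r(1) less_imp_le)
  qed
  have c2: "cmod (rot 2 - 1) = 2" and c3: "cmod (rot 3 - 1) = sqrt 3"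
    and c4: "cmod (rot 4 - 1) = sqrt 2" and c6: "cmod (rot 6 - 1) = 1"
    by (simp_all add: cmod_rot_minus_one sin_60 sin_45 sin_30)
  consider "m = 3" "n = 3" "\<nu> = 6 * sqrt 3" "q\<^sub>0 = 6" | "m = 2" "n = 3" "\<nu> = 24 * sqrt 3" "q\<^sub>0 = 6"
    | "m = 2" "n = 6" "\<nu> = 4 * sqrt 3" "q\<^sub>0 = 4" | "m = 4" "n = 4" "\<nu> = 4" "q\<^sub>0 = 4"
    using tab q by (auto simp: triangle_types_def)
  then show ?thesis
  proof cases
    case 1
    have "\<exists>z\<in>S. z \<noteq> 0 \<and> s\<^sup>2 / 3 * (cmod z)\<^sup>2 < 1 \<or> z \<noteq> 1 \<and> s\<^sup>2 / 3 * (cmod (z - 1))\<^sup>2 < 1"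
    proof (rule descent_symmetric[OF ne, where u = "rot 3" and \<kappa> = "1 / 2" and r = r])
      show "0 < s\<^sup>2 / 3" "s\<^sup>2 / 3 < 1" "s\<^sup>2 / 3 * r\<^sup>2 \<le> 1"
        using s_6[OF 1(4)] s1 r by (simp_all add: mult.commute)
      show "\<exists>y\<in>S'. cmod y = cmod x \<and> 1 / 2 * cmod x \<le> Re y"
        if "\<And>x. x \<in> S' \<Longrightarrow> rot 3 * x \<in> S'" "x \<in> S'" for S' x
        using that by (rule rotate_3)
    qed (use rot r r1 1 in simp_all)
    then show ?thesis
      using 1 by (auto simp: c3 field_simps)
  next
    case 2
    have "1 \<in> S \<or> (\<exists>z\<in>S. z \<noteq> 1 \<and> cmod (z - 1) < 2 * r)"
    proof (rule descent_half[OF ne, where u = "rot 3" and \<kappa> = "1 / 2" and r = r])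
      show "\<exists>y\<in>S'. cmod y = cmod x \<and> 1 / 2 * cmod x \<le> Re y"
        if "\<And>x. x \<in> S' \<Longrightarrow> rot 3 * x \<in> S'" "x \<in> S'" for S' x
        using that by (rule rotate_3)
    qed (use rot r r1 2 in \<open>simp_all add: rot_2\<close>)
    \<comment> \<open>Settles the case that the descent lands on the centre 1, through the bound
      around 0.\<close>
    moreover have "4 * s\<^sup>2 < 24 * sqrt 3"
    proof -
      have "1 < sqrt (3::real)"
        by simp
      with s_6[OF 2(4)] show ?thesis
        by linarith
    qed
    moreover have "2 * s\<^sup>2 * sqrt 3 * (cmod (z - 1))\<^sup>2 < 24 * sqrt 3" if "cmod (z - 1) < 2 * r" for z
    proof -
      have "(cmod (z - 1))\<^sup>2 < (2 * r)\<^sup>2"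
        using that by (intro power_strict_mono) auto
      then have "s\<^sup>2 * (cmod (z - 1))\<^sup>2 < s\<^sup>2 * (2 * r)\<^sup>2"
        using s1 by simp
      also have "\<dots> = 12"
        using r by (simp add: power_mult_distrib mult.commute)
      finally show ?thesis
        by simp
    qed
    ultimately show ?thesis
      using 2 by (auto simp: c3 c2 intro: bexI[of _ 1])
  next
    case 3
    \<comment> \<open>The radius 9/10 used below exceeds sqrt 2 / 2, as the descent needs, and still
      satisfies 2 (2r)^2 < 4 sqrt 3; these two estimates say so.\<close>
    have sqrt2: "10 / 9 < sqrt 2" and sqrt3: "81 / 50 < sqrt 3"
      by (rule real_less_rsqrt; simp add: power2_eq_square)+
    have "1 \<in> S \<or> (\<exists>z\<in>S. z \<noteq> 1 \<and> cmod (z - 1) < 2 * (9 / 10))"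
    proof (rule descent_half[OF ne, where u = "rot 6" and \<kappa> = "sqrt 2 / 2"])
      show "\<exists>y\<in>S'. cmod y = cmod x \<and> sqrt 2 / 2 * cmod x \<le> Re y"
        if "\<And>x. x \<in> S' \<Longrightarrow> rot 6 * x \<in> S'" "x \<in> S'" for S' x
        using that by (rule rotate_6)
    qed (use rot 3 sqrt2 in \<open>simp_all add: rot_2\<close>)
    moreover have "2 * (cmod (z - 1))\<^sup>2 < 4 * sqrt 3" if "cmod (z - 1) < 2 * (9 / 10)" for z
    proof -
      have "(cmod (z - 1))\<^sup>2 < (2 * (9 / 10))\<^sup>2"
        using that by (intro power_strict_mono) auto
      then show ?thesis
        using sqrt3 by (simp add: power2_eq_square)
    qed
    ultimately show ?thesis
      using 3 s_q3 sqrt3 by (auto simp: c6 c2 intro: bexI[of _ 1])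
  next
    case 4
    have sqrt2: "1 < sqrt 2"
      by simp
    have "\<exists>z\<in>S. z \<noteq> 0 \<and> sqrt 2 / 2 * (cmod z)\<^sup>2 < 1 \<or> z \<noteq> 1 \<and> sqrt 2 / 2 * (cmod (z - 1))\<^sup>2 < 1"
    proof (rule descent_symmetric[OF ne, where u = "rot 4" and \<kappa> = "sqrt 2 / 2" and r = 1])
      show "sqrt 2 / 2 < 1" "sqrt 2 / 2 * 1\<^sup>2 \<le> (1::real)"
        using sqrt2_less_2 by simp_all
      show "\<exists>y\<in>S'. cmod y = cmod x \<and> sqrt 2 / 2 * cmod x \<le> Re y"
        if "\<And>x. x \<in> S' \<Longrightarrow> rot 4 * x \<in> S'" "x \<in> S'" for S' x
        using that by (rule rotate_4)
    qed (use rot 4 in simp_all)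
    then show ?thesis
      using 4 s_q3 by (auto simp: c4)
  qed
qed

text \<open>\<open>Hecke_discrete\<close> yields the cosine with some \<open>q \<ge> 3\<close>; if
  \<open>q < q\<^sub>0\<close>, then \<open>small_orbit_point\<close> contradicts
  \<open>orbit_lower_bound\<close>.\<close>

lemma (in PU21_subgroup) discrete_imp_cos:
  assumes disc: "discrete_in_PU21 \<Gamma>" and tab: "(m, n, \<nu>, q\<^sub>0) \<in> triangle_types"
    and c: "herm c\<^sub>1 c\<^sub>1 = 1" "herm c\<^sub>2 c\<^sub>2 = 1" "herm c\<^sub>1 c\<^sub>2 = 1" "herm e e = 1"
    and R: "pert (rot m - 1) c\<^sub>1 \<in> lift \<Gamma>" "pert (rot n - 1) c\<^sub>2 \<in> lift \<Gamma>" "pert (-2) e \<in> lift \<Gamma>"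
  defines "D \<equiv> (cmod (herm (c\<^sub>1 - c\<^sub>2) e))\<^sup>2"
  assumes D: "0 < D" "D < 2 / \<nu>"
  shows "\<exists>q\<ge>q\<^sub>0. D = 2 * cos (pi / real q) / \<nu>"
proof -
  define p where "p = c\<^sub>1 - c\<^sub>2"
  have "herm c\<^sub>2 c\<^sub>1 = 1"
    using cnj_herm[of c\<^sub>1 c\<^sub>2] c by simp
  then have p: "herm p p = 0"
    by (simp add: p_def herm_simps c)
  have \<nu>: "0 < \<nu>" and mn: "1 < m" "1 < n"
    using tab by (auto simp: triangle_types_def)
  have T: "pert (\<i> * of_real (\<nu> / 2)) p \<in> lift \<Gamma>"
    using vertical_translation_length[OF tab] vertical_translation[OF c(1-3) R(1,2)] unfolding p_def by metis
  have s: "2 * (\<nu> / 2) * (cmod (herm p e))\<^sup>2 = \<nu> * D"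
    by (simp add: D_def p_def)
  have "\<nu> * D < 2"
    using D \<nu> by (simp add: field_simps)
  then obtain q :: nat where q: "3 \<le> q" "\<nu> * D = 2 * cos (pi / q)"
    using Hecke_discrete[OF disc p T R(3) c(4)] D(1) \<nu> unfolding s by auto
  have "q\<^sub>0 \<le> q"
  proof (rule ccontr)
    assume "\<not> q\<^sub>0 \<le> q"
    then have less: "q < q\<^sub>0"
      by simp
    have pe: "herm p e \<noteq> 0"
      using D by (auto simp: D_def p_def)
    have ne: "orbit c\<^sub>1 p e \<noteq> {}"
      using lift_one by (auto simp: orbit_def intro!: exI[of _ "mat 1"])
    note rotate = orbit_rotate[OF c(1-3) R(1,2), folded p_def, OF pe]
    obtain z where z: "z \<in> orbit c\<^sub>1 p e"
      and small: "z \<noteq> 0 \<and> 2 * (\<nu> * D)\<^sup>2 * cmod (rot m - 1) * (cmod z)\<^sup>2 < \<nu> \<or>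
        z \<noteq> 1 \<and> 2 * (\<nu> * D)\<^sup>2 * cmod (rot n - 1) * (cmod (z - 1))\<^sup>2 < \<nu>"
      using small_orbit_point[OF tab q(1) less q(2) ne rotate] by blast
    have rot1: "rot m - 1 \<noteq> 0" "rot n - 1 \<noteq> 0"
      using mn sin_gt_zero[of "pi / m"] sin_gt_zero[of "pi / n"] by (auto simp: rot_minus_one field_simps)
    have d: "\<i> * of_real (\<nu> / 2) \<noteq> (0 :: complex)" "cmod (\<i> * of_real (\<nu> / 2)) = \<nu> / 2"
      using \<nu> by (auto simp: norm_mult)
    have Dp: "(cmod (herm p e))\<^sup>2 = D"
      by (simp add: D_def p_def)
    note lower = orbit_lower_bound[OF disc c(1-3) R rot1, folded p_def, OF T d(1) pe z, unfolded d(2) Dp]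
    have scale: "2 * (\<nu> * D)\<^sup>2 * x * y = \<nu> * (4 * (\<nu> / 2) * x * D\<^sup>2 * y)" for x y
      by (simp add: power2_eq_square)
    have "\<not> \<nu> * x < \<nu>" if "1 \<le> x" for x
      using that \<nu> by simp
    then show False
      using small lower unfolding scale by blast
  qed
  then show ?thesis
    using q \<nu> by (intro exI[of _ q]) (auto simp: field_simps)
qed

text \<open>Rescaling the polar vector cancels against the division by \<open>herm c' c'\<close>.
  The factor -1 is a unit scalar and disappears in PU(2,1).\<close>

lemma matrix_reflection_map:
  assumes "normalised_polar_vector c C" "polar_vector c' C"
  shows "matrix (reflection_map n c') = mat (-1) ** pert (rot n - 1) c"
proof -
  have c: "herm c c = 1" "polar_vector c C"
    using assms by (simp_all add: normalised_polar_vector_def)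
  obtain k where k: "k \<noteq> 0" "c' = k *s c"
    using polar_vector_unique[OF c(2) assms(2)] by blast
  have "reflection_map n c' z = (mat (-1) ** pert (rot n - 1) c) *v z" for z
  proof -
    have "(1 - rot n) * (herm z c' / herm c' c') * k = (1 - rot n) * herm z c"
      using k by (simp add: herm_simps c)
    then have "((1 - rot n) * (herm z c' / herm c' c')) *s c' = ((1 - rot n) * herm z c) *s c"
      unfolding k(2) by (simp add: vec_eq_iff mult.assoc)
    then show ?thesis
      by (simp add: reflection_map_def flip: rot_def matrix_vector_mul_assoc)
         (simp add: mat_mult_vector pert_apply vec_eq_iff algebra_simps)
  qed
  then have "reflection_map n c' = (*v) (mat (-1) ** pert (rot n - 1) c)"
    by blast
  then show ?thesis
    by simp
qed

lemma minimal_reflection_pert: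
  assumes "normalised_polar_vector c C" "minimal_reflection n C g"
  shows "pert (rot n - 1) c \<in> carrier U21" "g = proj_class (pert (rot n - 1) c)"
proof -
  show in_U21: "pert (rot n - 1) c \<in> carrier U21"
    using assms(1) by (intro pert_in_U21) (simp_all add: normalised_polar_vector_def)
  obtain c' where "polar_vector c' C" "g = proj_class (matrix (reflection_map n c'))"
    using assms(2) by (auto simp: minimal_reflection_def)
  then show "g = proj_class (pert (rot n - 1) c)"
    using matrix_reflection_map[OF assms(1)] proj_class_mat_mult[of "-1", OF _ in_U21] by simp
qed

lemma normalised_polar_vector_scale:
  assumes "normalised_polar_vector c C" "cmod u = 1"
  shows "normalised_polar_vector (u *s c) C"
proof -
  have "u \<noteq> 0"
    using assms(2) by auto
  then have "herm (u *s c) z = 0 \<longleftrightarrow> herm c z = 0" for z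
    by (simp add: herm_simps)
  moreover have "herm (u *s c) (u *s c) = (cnj u * u) * herm c c"
    by (simp add: herm_simps)
  ultimately show ?thesis
    using assms cnj_mult_unit[OF assms(2)] by (simp add: normalised_polar_vector_def polar_vector_def)
qed

text \<open>Taking both geodesics equal in \<open>herm_geodesics_approximation\<close> produces a
  negative vector orthogonal to \<open>c\<close>; the error 1 is arbitrary.\<close>

lemma geodesic_Int_H2C_nonempty:
  assumes "normalised_polar_vector c C"
  shows "C \<inter> H2C \<noteq> {}"
proof -
  have c: "polar_vector c C" "herm c c = 1"
    using assms by (auto simp: normalised_polar_vector_def)
  obtain z where "Re (herm z z) < 0" "herm c z = 0"
    using herm_geodesics_approximation[of c c 1] c by auto
  then show ?thesis
    unfolding geodesic_Int_H2C[OF c(1)] by blast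
qed

theorem proposition1p3:
  fixes m :: "3 \<Rightarrow> real" and n :: "3 \<Rightarrow> nat" and C :: "3 \<Rightarrow> cpoint set"
    and \<Gamma> :: "(complex ^ 3 ^ 3) set set" and \<alpha> D \<nu>\<^sub>1 :: real and q\<^sub>0 :: nat
  assumes "triangle_group m n C \<Gamma>"
    and "(\<Inter>k. C k) \<inter> bdry_H2C = {}"
    and "m 3 = 0" and "n 3 = 2"
    and "angular_invariant C \<alpha>"
    and "(n 1, n 2, \<nu>\<^sub>1, q\<^sub>0) \<in>
           {(3, 3, 6 * sqrt 3, 6), (2, 3, 24 * sqrt 3, 6), (2, 6, 4 * sqrt 3, 4),
            (3, 6, 2 * sqrt 3, 3), (2, 4, 16, 3), (4, 4, 4, 4)}"
    and "D = 4 * cosh (m 1 / 2) * cosh (m 2 / 2) * (sin (\<alpha> / 2))\<^sup>2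
             + (cosh (m 1 / 2) - cosh (m 2 / 2))\<^sup>2"
    and "D < 2 / \<nu>\<^sub>1"
    and "\<forall>q::nat. q \<ge> q\<^sub>0 \<longrightarrow> D \<noteq> 2 * cos (pi / real q) / \<nu>\<^sub>1"
  shows "\<not> discrete_in_PU21 \<Gamma>"
proof
  assume disc: "discrete_in_PU21 \<Gamma>"
  have idx: "(1::3) - 1 = 3" "(1::3) + 1 = 2" "(2::3) - 1 = 1" "(2::3) + 1 = 3" "(3::3) - 1 = 2" "(3::3) + 1 = 1"
    by simp_all
  have distinct: "(1::3) \<noteq> 2" "(1::3) \<noteq> 3" "(2::3) \<noteq> 3"
    by simp_all
  obtain \<iota> where \<iota>: "\<And>k. minimal_reflection (n k) (C k) (\<iota> k)" and \<Gamma>: "\<Gamma> = generate PU21 (range \<iota>)"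
    and tri: "ultraparallel_triangle m C"
    using assms(1) by (auto simp: triangle_group_def)
  have disj: "C j \<inter> C k \<inter> H2C = {}" if "j \<noteq> k" for j k
    using tri that by (simp add: ultraparallel_triangle_def)
  have dist: "geodesic_dist (C (k - 1)) (C (k + 1)) = m k" for k
    using tri by (simp add: ultraparallel_triangle_def)
  obtain c where c: "\<And>k. normalised_polar_vector (c k) (C k)"
    and arg: "is_Arg (\<Prod>k\<in>UNIV. herm (c (k - 1)) (c (k + 1))) \<alpha>"
    using assms(5) by (auto simp: angular_invariant_def)
  have cc: "herm (c k) (c k) = 1" and polar: "polar_vector (c k) (C k)" for k
    using c[of k] by (simp_all add: normalised_polar_vector_def)
  have cosh: "cmod (herm (c (k - 1)) (c (k + 1))) = cosh (m k / 2)" if "k - 1 \<noteq> k + 1" for k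
    using cosh_geodesic_dist[OF c c disj[OF that]] dist[of k] by simp
  have cosh3: "cmod (herm (c 2) (c 1)) = 1"
    using cosh[of 3, unfolded idx] assms(3) distinct by simp
  have cosh1: "cmod (herm (c 3) (c 2)) = cosh (m 1 / 2)" and cosh2: "cmod (herm (c 1) (c 3)) = cosh (m 2 / 2)"
    using cosh[of 1, unfolded idx] cosh[of 2, unfolded idx] distinct by simp_all
  have pert_U21: "pert (rot (n k) - 1) (c k) \<in> carrier U21" and \<iota>_eq: "\<iota> k = proj_class (pert (rot (n k) - 1) (c k))" for k
    using minimal_reflection_pert[OF c \<iota>] by blast+
  have "range \<iota> \<subseteq> carrier PU21"
    using pert_U21 \<iota>_eq proj_class.hom_closed by auto
  then interpret PU21_subgroup \<Gamma>
    unfolding \<Gamma> PU21_subgroup_def by (rule PU21.generate_is_subgroup)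
  have R: "pert (rot (n k) - 1) (c k) \<in> lift \<Gamma>" for k
    unfolding lift_def mem_Collect_eq \<iota>_eq[symmetric] \<Gamma>
    using pert_U21 by (intro conjI generate.incl) simp_all
  \<comment> \<open>Unimodular because \<open>m 3 = 0\<close>, so \<open>c 2\<close> can be scaled
    by it without losing normalisation, making the product with \<open>c 1\<close> equal to
    1.\<close>
  define u where "u = herm (c 1) (c 2)"
  have u: "cmod u = 1"
    using cosh3 cmod_herm_commute[of "c 1" "c 2"] by (simp add: u_def)
  define c2 where "c2 = u *s c 2"
  have c2: "normalised_polar_vector c2 (C 2)" "herm (c 1) c2 = 1" "herm c2 (c 1) = 1"
    using normalised_polar_vector_scale[OF c u] cnj_mult_unit[OF u] cnj_herm[of "c 1" "c 2"]
    by (simp_all add: c2_def herm_simps u_def mult.commute)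
  have c22: "herm c2 c2 = 1" "polar_vector c2 (C 2)"
    using c2 by (simp_all add: normalised_polar_vector_def)
  have R2: "pert (rot (n 2) - 1) c2 \<in> lift \<Gamma>"
    using R[of 2] pert_unit_scale[OF u] by (simp add: c2_def)
  have R3: "pert (-2) (c 3) \<in> lift \<Gamma>"
    using R[of 3] by (simp add: assms(4) rot_2)
  define p where "p = c 1 - c2"
  have D: "(cmod (herm p (c 3)))\<^sup>2 = D"
  proof -
    define P where "P = herm (c 1) (c 3) * herm (c 3) (c 2) * herm (c 2) (c 1)"
    have "(\<Prod>k\<in>UNIV. herm (c (k - 1)) (c (k + 1))) =
        herm (c (1 - 1)) (c (1 + 1)) * (herm (c (2 - 1)) (c (2 + 1)) * herm (c (3 - 1)) (c (3 + 1)))"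
      unfolding UNIV_3 by simp
    also have "\<dots> = P"
      by (simp only: idx P_def mult_ac)
    finally have "P = of_real (cmod P) * exp (\<i> * of_real \<alpha>)"
      using arg unfolding is_Arg_def by simp
    then have "Re P = Re (of_real (cmod P) * exp (\<i> * of_real \<alpha>))"
      by (rule arg_cong)
    then have "Re P = cmod P * cos \<alpha>"
      by (simp add: Re_exp)
    moreover have "cmod P = cosh (m 1 / 2) * cosh (m 2 / 2)"
      by (simp add: P_def norm_mult cosh1 cosh2 cosh3)
    ultimately have ReP: "Re P = cosh (m 1 / 2) * cosh (m 2 / 2) * cos \<alpha>"
      by simp
    \<comment> \<open>Thanks to the scaling, the cross term of |<c1,c3> - <c2,c3>|^2 is the triple
      product, whose argument is \<alpha>.\<close>
    have prod: "herm (c 1) (c 3) * cnj (herm c2 (c 3)) = P"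
      by (simp add: P_def c2_def herm_simps u_def cnj_herm mult_ac)
    have square: "(cmod (x - y))\<^sup>2 = (cmod x)\<^sup>2 + (cmod y)\<^sup>2 - 2 * Re (x * cnj y)" for x y
      by (simp add: cmod_power2 power2_diff)
    have "(cmod (herm p (c 3)))\<^sup>2 =
        (cmod (herm (c 1) (c 3)))\<^sup>2 + (cmod (herm c2 (c 3)))\<^sup>2 - 2 * Re P"
      unfolding p_def herm_diff_left square prod ..
    also have "cmod (herm c2 (c 3)) = cosh (m 1 / 2)"
      using u cosh1 cmod_herm_commute[of "c 3" "c 2"] by (simp add: c2_def herm_simps norm_mult)
    finally have "(cmod (herm p (c 3)))\<^sup>2 = (cosh (m 2 / 2))\<^sup>2 + (cosh (m 1 / 2))\<^sup>2
        - 2 * (cosh (m 1 / 2) * cosh (m 2 / 2) * cos \<alpha>)"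
      by (simp add: ReP cosh2)
    moreover have "cos \<alpha> = 1 - 2 * (sin (\<alpha> / 2))\<^sup>2"
      using cos_double_sin[of "\<alpha> / 2"] by simp
    ultimately show ?thesis
      unfolding assms(7) by (simp add: power2_diff algebra_simps)
  qed
  have "p \<noteq> 0"
  proof
    assume "p = 0"
    then have "c 1 = c2"
      by (simp add: p_def)
    then have "C 1 \<inter> H2C = C 2 \<inter> H2C"
      using geodesic_Int_H2C[OF polar[of 1]] geodesic_Int_H2C[OF c22(2)] by simp
    then show False
      using disj[OF distinct(1)] geodesic_Int_H2C_nonempty[OF c, of 1] by blast
  qed
  \<comment> \<open>Otherwise the boundary point spanned by \<open>p\<close> would lie on all three
    geodesics. This gives \<open>0 < D\<close>, without which the quantities in Shimizu's lemma
    would vanish.\<close>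
  have "herm p (c 3) \<noteq> 0"
  proof
    assume "herm p (c 3) = 0"
    then have "herm (c 3) p = 0"
      by (metis cnj_herm complex_cnj_zero)
    moreover have "herm (c 1) p = 0" "herm c2 p = 0" "herm p p = 0"
      by (simp_all add: p_def herm_simps cc c2 c22)
    ultimately have mem: "vec.span {p} \<in> C 1" "vec.span {p} \<in> C 2" "vec.span {p} \<in> C 3" "vec.span {p} \<in> bdry_H2C"
      using line_mem_geodesic_iff[OF polar \<open>p \<noteq> 0\<close>] line_mem_geodesic_iff[OF c22(2) \<open>p \<noteq> 0\<close>] \<open>p \<noteq> 0\<close>
      by (auto simp: bdry_H2C_def)
    have "vec.span {p} \<in> C k" for k
      using exhaust_3[of k] mem(1-3) by (elim disjE) (simp_all only:)
    with mem(4) have "vec.span {p} \<in> (\<Inter>k. C k) \<inter> bdry_H2C"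
      by blast
    with assms(2) show False
      by blast
  qed
  then have "0 < D"
    by (simp flip: D)
  then obtain q where "q \<ge> q\<^sub>0" "D = 2 * cos (pi / real q) / \<nu>\<^sub>1"
    using discrete_imp_cos[OF disc _ cc c22(1) c2(2) cc R R2 R3, of \<nu>\<^sub>1 q\<^sub>0] assms(6,8)
    unfolding triangle_types_def p_def[symmetric] D by blast
  with assms(9) show False
    by blast
qed

end
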